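(* Let $H$ be a Hilbert space and let $A\subseteq B(H)$ be a subalgebra containing the identity operator $1$ (not necessarily self-adjoint), normed by the operator norm. If there is a diagonal in the Haagerup tensor product $A\otimes_h A$, then $A$ is finite dimensional.
   Context: For $w$ in the algebraic tensor product $A\otimes A$, the Haagerup norm is $\|w\|_h=\inf\{\|\sum_i a_ia_i^*\|^{1/2}\,\|\sum_i b_i^*b_i\|^{1/2}\}$, the infimum over all representations $w=\sum_i a_i\otimes b_i$ as finite sums of elementary tensors; $A\otimes_h A$ denotes the completion of $A\otimes A$ in this norm. The multiplication map $a\otimes b\mapsto ab$ extends to a contractive linear map $m$ from $A\otimes_h A$ into the norm closure of $A$ in $B(H)$, and for each $a\in A$ the maps $b\otimes c\mapsto ab\otimes c$ and $b\otimes c\mapsto b\otimes ca$ extend to bounded maps $u\mapsto a\cdot u$ and $u\mapsto u\cdot a$ on $A\otimes_h A$. A diagonal in $A\otimes_h A$ is an element $u\in A\otimes_h A$ with $m(u)=1$ and $a\cdot u=u\cdot a$ for every $a\in A$ (equivalently, $u=\sum_{i=1}^\infty a_i\otimes b_i$ norm convergent with $\sum_i a_ib_i=1$ and $\sum_i aa_i\otimes b_i=\sum_i a_i\otimes b_ia$ for all $a\in A$). *)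

theory Defs
  imports "HOL-Analysis.Analysis"
begin

class complex_inner = real_normed_vector +
  fixes scaleC :: "complex \<Rightarrow> 'a \<Rightarrow> 'a"
    and cinner :: "'a \<Rightarrow> 'a \<Rightarrow> complex"
  assumes scaleC_add_right: "scaleC c (x + y) = scaleC c x + scaleC c y"
    and scaleC_add_left: "scaleC (c + d) x = scaleC c x + scaleC d x"
    and scaleC_scaleC: "scaleC c (scaleC d x) = scaleC (c * d) x"
    and scaleC_of_real: "scaleC (complex_of_real r) x = scaleR r x"
    and cinner_commute: "cinner x y = cnj (cinner y x)"
    and cinner_add_right: "cinner x (y + z) = cinner x y + cinner x z"
    and cinner_scaleC_right: "cinner x (scaleC c y) = c * cinner x y"
    and cinner_self_norm: "cinner x x = complex_of_real ((norm x)\<^sup>2)"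

class chilbert_space = complex_inner + complete_space

instantiation complex :: chilbert_space
begin
definition scaleC_complex :: "complex \<Rightarrow> complex \<Rightarrow> complex" where
  "scaleC_complex c x = c * x"
definition cinner_complex :: "complex \<Rightarrow> complex \<Rightarrow> complex" where
  "cinner_complex x y = cnj x * y"
instance
proof
  fix x y z c d :: complex and r :: real
  show "scaleC c (x + y) = scaleC c x + scaleC c y"
    by (simp add: scaleC_complex_def algebra_simps)
  show "scaleC (c + d) x = scaleC c x + scaleC d x"
    by (simp add: scaleC_complex_def algebra_simps)
  show "scaleC c (scaleC d x) = scaleC (c * d) x"
    by (simp add: scaleC_complex_def algebra_simps)
  show "scaleC (complex_of_real r) x = scaleR r x"
    by (simp add: scaleC_complex_def scaleR_conv_of_real)
  show "cinner x y = cnj (cinner y x)"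
    by (simp add: cinner_complex_def)
  show "cinner x (y + z) = cinner x y + cinner x z"
    by (simp add: cinner_complex_def algebra_simps)
  show "cinner x (scaleC c y) = c * cinner x y"
    by (simp add: cinner_complex_def scaleC_complex_def algebra_simps)
  show "cinner x x = complex_of_real ((norm x)\<^sup>2)"
    by (metis cinner_complex_def complex_norm_square mult.commute)
qed
end

definition bounded_ops :: "('h::chilbert_space \<Rightarrow> 'h) set" where
  "bounded_ops = {T. bounded_linear T \<and> (\<forall>c x. T (scaleC c x) = scaleC c (T x))}"

definition adj :: "('h::chilbert_space \<Rightarrow> 'h) \<Rightarrow> 'h \<Rightarrow> 'h" where
  "adj T = (\<lambda>y. THE z. \<forall>x. cinner (T x) y = cinner x z)"

definition unital_subalgebra :: "('h::chilbert_space \<Rightarrow> 'h) set \<Rightarrow> bool" where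
  "unital_subalgebra A \<longleftrightarrow> A \<subseteq> bounded_ops \<and> id \<in> A \<and>
     (\<forall>S\<in>A. \<forall>T\<in>A. (\<lambda>x. S x + T x) \<in> A) \<and>
     (\<forall>c. \<forall>T\<in>A. (\<lambda>x. scaleC c (T x)) \<in> A) \<and>
     (\<forall>S\<in>A. \<forall>T\<in>A. S \<circ> T \<in> A)"

definition finite_dim_ops :: "('h::chilbert_space \<Rightarrow> 'h) set \<Rightarrow> bool" where
  "finite_dim_ops A \<longleftrightarrow> (\<exists>F. finite F \<and> F \<subseteq> A \<and>
     (\<forall>T\<in>A. \<exists>c. T = (\<lambda>x. \<Sum>f\<in>F. scaleC (c f) (f x))))"

text \<open>A finite list [(a_1,b_1),...,(a_n,b_n)] represents the algebraic tensor
 sum_i a_i \<otimes> b_i. Two lists represent the same element of B(H) \<otimes> B(H)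
 (hence of A \<otimes> A) iff they induce the same 4-linear form below
 (vector functionals separate the points of B(H)).\<close>
definition tens :: "(('h::chilbert_space \<Rightarrow> 'h) \<times> ('h \<Rightarrow> 'h)) list \<Rightarrow> 'h \<Rightarrow> 'h \<Rightarrow> 'h \<Rightarrow> 'h \<Rightarrow> complex" where
  "tens L = (\<lambda>\<xi> x \<eta> y. \<Sum>(a, b)\<leftarrow>L. cinner \<xi> (a x) * cinner \<eta> (b y))"

definition row_fac :: "(('h::chilbert_space \<Rightarrow> 'h) \<times> ('h \<Rightarrow> 'h)) list \<Rightarrow> real" where
  "row_fac L = sqrt (onorm (\<lambda>x. \<Sum>(a, b)\<leftarrow>L. a (adj a x)))"

definition col_fac :: "(('h::chilbert_space \<Rightarrow> 'h) \<times> ('h \<Rightarrow> 'h)) list \<Rightarrow> real" where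
  "col_fac L = sqrt (onorm (\<lambda>x. \<Sum>(a, b)\<leftarrow>L. adj b (b x)))"

definition haagerup_norm :: "('h::chilbert_space \<Rightarrow> 'h) set \<Rightarrow> (('h \<Rightarrow> 'h) \<times> ('h \<Rightarrow> 'h)) list \<Rightarrow> real" where
  "haagerup_norm A L = Inf {row_fac L' * col_fac L' | L'. set L' \<subseteq> A \<times> A \<and> tens L' = tens L}"

text \<open>Following the equivalent description in the paper: u = sum_i a_i \<otimes> b_i,
 convergent in the Haagerup norm (i.e. partial sums are Cauchy in A \<otimes> A, so
 define an element of the completion), with sum_i a_i b_i = 1 (norm convergent
 in B(H)) and sum_i a a_i \<otimes> b_i = sum_i a_i \<otimes> b_i a in A \<otimes>_h A for all a \<in> A
 (equality of limits in the completion = Haagerup norm of the difference of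
 the partial sums tends to 0).\<close>
definition has_diagonal :: "('h::chilbert_space \<Rightarrow> 'h) set \<Rightarrow> bool" where
  "has_diagonal A \<longleftrightarrow> (\<exists>a b :: nat \<Rightarrow> 'h \<Rightarrow> 'h.
     (\<forall>i. a i \<in> A \<and> b i \<in> A) \<and>
     (\<forall>e>0. \<exists>N. \<forall>m n. N \<le> m \<longrightarrow> m \<le> n \<longrightarrow>
         haagerup_norm A (map (\<lambda>i. (a i, b i)) [m..<n]) < e) \<and>
     (\<lambda>n. onorm (\<lambda>x. (\<Sum>i<n. a i (b i x)) - x)) \<longlonglongrightarrow> 0 \<and>
     (\<forall>c\<in>A. (\<lambda>n. haagerup_norm A
         (map (\<lambda>i. (c \<circ> a i, b i)) [0..<n] @ map (\<lambda>i. (- a i, b i \<circ> c)) [0..<n]))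
       \<longlonglongrightarrow> 0))"

end

theory Submission
  imports Defs
begin

text \<open>Write the diagonal as \<open>u = \<Sum>\<^sub>k a\<^sub>k \<otimes> b\<^sub>k\<close> with \<open>\<Sum> a\<^sub>k a\<^sub>k\<^sup>*\<close> and \<open>\<Sum> b\<^sub>k\<^sup>* b\<^sub>k\<close> norm convergent. Slicing
  \<open>c \<cdot> u = u \<cdot> c\<close> by a functional \<open>g\<close> on the right leg gives \<open>c (\<Sum>\<^sub>k g(b\<^sub>k) a\<^sub>k) = \<Sum>\<^sub>k g(b\<^sub>k c) a\<^sub>k\<close>, which up to
  a small multiple of \<open>\<parallel>c\<parallel>\<close> depends only on finitely many of the numbers \<open>g(b\<^sub>k c)\<close>. Let \<open>P\<close> be the
  projection of \<open>\<ell>\<^sup>2\<close> onto the closure of the sequences \<open>(g(b\<^sub>k))\<^sub>k\<close>; replacing the row \<open>a\<close> by \<open>a P\<close> and the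
  column \<open>b\<close> by \<open>P b = b\<close> shows that \<open>1 = \<Sum> a\<^sub>i b\<^sub>i\<close> is a norm limit of finite sums
  \<open>\<Sum>\<^sub>i (\<Sum>\<^sub>k g\<^sub>i(b\<^sub>k) a\<^sub>k) b\<^sub>i\<close>. Hence finitely many linear functionals \<open>c \<mapsto> g(b\<^sub>k c)\<close> have trivial joint
  kernel on \<open>A\<close>.\<close>

section \<open>Complex inner products and adjoints\<close>

lemma scaleC_zero_left [simp]: "scaleC 0 (x::'a::complex_inner) = 0"
  using scaleC_of_real[of 0 x] by simp

lemma scaleC_one [simp]: "scaleC 1 (x::'a::complex_inner) = x"
  using scaleC_of_real[of 1 x] by simp

lemma scaleC_minus_one: "scaleC (-1) (x::'a::complex_inner) = - x"
  using scaleC_of_real[of "-1" x] by simp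

lemma scaleC_zero_right [simp]: "scaleC c (0::'a::complex_inner) = 0"
  using scaleC_add_right[of c "0::'a" 0] by simp

lemma scaleC_minus_right: "scaleC c (- (x::'a::complex_inner)) = - scaleC c x"
  using scaleC_add_right[of c x "-x"] by (simp add: eq_neg_iff_add_eq_0 add.commute)

lemma scaleC_minus_left: "scaleC (- c) (x::'a::complex_inner) = - scaleC c x"
  using scaleC_add_left[of c "-c" x] by (simp add: eq_neg_iff_add_eq_0 add.commute)

lemma scaleC_diff_left: "scaleC (c - d) (x::'a::complex_inner) = scaleC c x - scaleC d x"
  using scaleC_add_left[of c "-d" x] by (simp add: scaleC_minus_left)

lemma cinner_zero_right [simp]: "cinner x (0::'a::complex_inner) = 0"
  using cinner_add_right[of x 0 0] by simp

lemma cinner_minus_right: "cinner x (- (y::'a::complex_inner)) = - cinner x y"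
  using cinner_add_right[of x y "-y"] by (simp add: eq_neg_iff_add_eq_0 add.commute)

lemma cinner_diff_right: "cinner x (y - z::'a::complex_inner) = cinner x y - cinner x z"
  using cinner_add_right[of x y "-z"] by (simp add: cinner_minus_right)

lemma cinner_add_left: "cinner (x + y) (z::'a::complex_inner) = cinner x z + cinner y z"
  by (metis cinner_add_right cinner_commute complex_cnj_add)

lemma cinner_scaleC_left: "cinner (scaleC c x) (z::'a::complex_inner) = cnj c * cinner x z"
  by (metis cinner_scaleC_right cinner_commute complex_cnj_mult)

lemma cinner_zero_left [simp]: "cinner (0::'a::complex_inner) x = 0"
  using cinner_add_left[of 0 0 x] by simp

lemma cinner_sum_right: "cinner (x::'a::complex_inner) (\<Sum>i\<in>F. f i) = (\<Sum>i\<in>F. cinner x (f i))"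
  by (induction F rule: infinite_finite_induct) (auto simp: cinner_add_right)

lemma cinner_sum_left: "cinner (\<Sum>i\<in>F. f i) (x::'a::complex_inner) = (\<Sum>i\<in>F. cinner (f i) x)"
  by (induction F rule: infinite_finite_induct) (auto simp: cinner_add_left)

lemma cinner_sum_list_right:
  "cinner (x::'a::complex_inner) (\<Sum>p\<leftarrow>L. f p) = (\<Sum>p\<leftarrow>L. cinner x (f p))"
  by (induction L) (auto simp: cinner_add_right)

lemma norm_scaleC: "norm (scaleC c (x::'a::complex_inner)) = cmod c * norm x"
proof -
  have "complex_of_real ((norm (scaleC c x))\<^sup>2) = c * cnj c * cinner x x"
    unfolding cinner_self_norm[symmetric] cinner_scaleC_left cinner_scaleC_right by simp
  then have "complex_of_real ((norm (scaleC c x))\<^sup>2) = complex_of_real ((cmod c * norm x)\<^sup>2)"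
    unfolding complex_norm_square[symmetric] cinner_self_norm by (simp add: power_mult_distrib)
  then have "(norm (scaleC c x))\<^sup>2 = (cmod c * norm x)\<^sup>2"
    using of_real_eq_iff by blast
  then show ?thesis by simp
qed

lemma norm_add_sq:
  "(norm (x + y::'a::complex_inner))\<^sup>2 = (norm x)\<^sup>2 + 2 * Re (cinner x y) + (norm y)\<^sup>2"
proof -
  have "complex_of_real ((norm (x + y))\<^sup>2)
      = of_real ((norm x)\<^sup>2) + (cinner x y + cnj (cinner x y)) + of_real ((norm y)\<^sup>2)"
    unfolding cinner_self_norm[symmetric] cinner_commute[of y x, symmetric]
    by (simp add: cinner_add_left cinner_add_right)
  then have "complex_of_real ((norm (x + y))\<^sup>2)
      = of_real ((norm x)\<^sup>2 + 2 * Re (cinner x y) + (norm y)\<^sup>2)"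
    by (simp add: complex_add_cnj)
  then show ?thesis using of_real_eq_iff by blast
qed

lemma norm_cinner_le: "cmod (cinner x y) \<le> norm x * norm (y::'a::complex_inner)"
proof (cases "y = 0")
  case False
  \<comment> \<open>The vector \<open>scaleC d y\<close> is minus the orthogonal projection of x
    onto the line of y; the claim comes from ||x + d y||^2 >= 0.\<close>
  define d where "d = - (cnj (cinner x y) / of_real ((norm y)\<^sup>2))"
  have "Re (cinner x (scaleC d y)) = - (cmod (cinner x y))\<^sup>2 / (norm y)\<^sup>2"
  proof -
    have "cinner x (scaleC d y) = of_real (- (cmod (cinner x y))\<^sup>2 / (norm y)\<^sup>2)"
      unfolding d_def cinner_scaleC_right
      using complex_norm_square[of "cinner x y"] by (simp add: mult.commute)
    then show ?thesis by simp
  qed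
  moreover have "(norm (scaleC d y))\<^sup>2 = (cmod (cinner x y))\<^sup>2 / (norm y)\<^sup>2"
    using False
    by (simp add: norm_scaleC d_def norm_divide power_mult_distrib power_divide norm_power
        norm_mult power2_eq_square)
  ultimately have "0 \<le> (norm x)\<^sup>2 - (cmod (cinner x y))\<^sup>2 / (norm y)\<^sup>2"
    using norm_add_sq[of x "scaleC d y"] zero_le_power2[of "norm (x + scaleC d y)"] by simp
  then have "(cmod (cinner x y))\<^sup>2 \<le> (norm x * norm y)\<^sup>2"
    using False by (simp add: field_simps power_mult_distrib)
  then show ?thesis by (rule power2_le_imp_le) simp
qed simp

lemma cinner_separates: "(\<And>z. cinner z x = cinner z y) \<Longrightarrow> x = (y::'a::complex_inner)"
proof -
  assume "\<And>z. cinner z x = cinner z y"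
  then have "cinner (x - y) (x - y) = 0" by (simp add: cinner_diff_right)
  then show "x = y" by (simp add: cinner_self_norm)
qed

lemma norm_le_if_cinner_le:
  assumes "\<And>z. cmod (cinner z x) \<le> K * norm z" and "0 \<le> K"
  shows "norm (x::'a::complex_inner) \<le> K"
proof (cases "x = 0")
  case False
  have "(norm x)\<^sup>2 \<le> K * norm x"
    using assms(1)[of x] by (simp add: cinner_self_norm norm_power)
  then show ?thesis using False by (simp add: power2_eq_square)
qed (use assms in simp)

section \<open>The Riesz representation theorem and adjoints\<close>

lemma quadratic_nonneg_imp_zero:
  fixes p q :: real
  assumes "\<And>t. 0 \<le> 2 * t * p + t\<^sup>2 * q"
  shows "p = 0"
proof (rule ccontr)
  assume "p \<noteq> 0"
  \<comment> \<open>For t = -p/s with s >= q, the quadratic term costs at most p^2/s against a gain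
    of 2 p^2/s from the linear one. The summand 1 keeps s positive.\<close>
  define s where "s = \<bar>q\<bar> + 1"
  have s: "s > 0" "q \<le> s" "s \<noteq> 0" by (auto simp: s_def)
  have "(-p/s)\<^sup>2 * q \<le> (-p/s)\<^sup>2 * s" using s by (intro mult_left_mono) auto
  also have "\<dots> = p\<^sup>2 / s" using s by (simp add: power2_eq_square field_simps)
  finally have "0 \<le> 2 * (-p/s) * p + p\<^sup>2/s" using assms[of "-p/s"] by linarith
  also have "\<dots> = - (p\<^sup>2 / s)" using s by (simp add: power2_eq_square field_simps)
  finally show False using s \<open>p \<noteq> 0\<close> by (simp add: divide_simps)
qed

text \<open>If z represents f, then \<Phi>(x) = ||x - z||^2 - ||z||^2, so z has to be the minimiser
  of \<open>\<Phi>\<close>. The parallelogram law makes a minimising sequence Cauchy, and the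
  vanishing first variation at its limit identifies f.\<close>

lemma riesz_representation:
  fixes f :: "'h::chilbert_space \<Rightarrow> complex"
  assumes add: "\<And>x y. f (x + y) = f x + f y"
    and scale: "\<And>c x. f (scaleC c x) = c * f x"
    and bound: "\<And>x. cmod (f x) \<le> K * norm x"
  shows "\<exists>z. \<forall>x. f x = cinner z x"
proof -
  define \<Phi> where "\<Phi> x = (norm x)\<^sup>2 - 2 * Re (f x)" for x
  have scaleR: "f (r *\<^sub>R x) = of_real r * f x" for r x
    using scale[of "of_real r" x] by (simp add: scaleC_of_real)
  have lb: "\<Phi> x \<ge> - (K\<^sup>2)" for x
  proof -
    have "2 * Re (f x) \<le> 2 * (K * norm x)"
      using complex_Re_le_cmod[of "f x"] bound[of x] by linarith
    moreover have "0 \<le> (norm x - K)\<^sup>2" by simp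
    ultimately show ?thesis unfolding \<Phi>_def by (simp add: power2_eq_square algebra_simps)
  qed
  have bdd: "bdd_below (range \<Phi>)" using lb by (auto simp: bdd_below_def)
  define m where "m = Inf (range \<Phi>)"
  have m: "m \<le> \<Phi> x" for x unfolding m_def using bdd by (simp add: cInf_lower)
  have "\<exists>x. \<Phi> x < m + 1 / real (Suc n)" for n
    using cInf_lessD[of "range \<Phi>" "m + 1 / real (Suc n)"] by (auto simp: m_def)
  then obtain X where X: "\<And>n. \<Phi> (X n) < m + 1 / real (Suc n)" by metis
  \<comment> \<open>This is the parallelogram law: the linear parts of \<open>\<Phi>\<close> cancel
    because f is additive.\<close>
  have par: "(norm (x - y))\<^sup>2 = 2 * (\<Phi> x + \<Phi> y - 2 * \<Phi> ((1/2) *\<^sub>R (x + y)))" for x y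
    using norm_add_sq[of x y] norm_add_sq[of x "-y"]
    unfolding \<Phi>_def scaleR add
    by (simp add: cinner_minus_right power_divide) (simp add: field_simps)
  have "(norm (x - y))\<^sup>2 \<le> 2 * (s + t)" if "\<Phi> x < m + s" "\<Phi> y < m + t" for x y s t
    using par[of x y] that m[of "(1/2) *\<^sub>R (x + y)"] by argo
  from this[OF X X]
  have close: "(norm (X n - X k))\<^sup>2 \<le> 2 * (1 / real (Suc n) + 1 / real (Suc k))" for n k .
  have "Cauchy X"
  proof (rule metric_CauchyI)
    fix e :: real assume e: "e > 0"
    obtain N where N: "inverse (real (Suc N)) < e\<^sup>2 / 4"
      using reals_Archimedean[of "e\<^sup>2/4"] e by auto
    have "dist (X n) (X k) < e" if "n \<ge> N" "k \<ge> N" for n k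
    proof -
      have "1 / real (Suc n) \<le> inverse (real (Suc N))" "1 / real (Suc k) \<le> inverse (real (Suc N))"
        using that by (auto simp: field_simps)
      then have "(norm (X n - X k))\<^sup>2 < e\<^sup>2" using close[of n k] N by argo
      then show ?thesis using e by (simp add: dist_norm power2_less_imp_less)
    qed
    then show "\<exists>N. \<forall>n\<ge>N. \<forall>k\<ge>N. dist (X n) (X k) < e" by blast
  qed
  then obtain z where z: "X \<longlonglongrightarrow> z" using Cauchy_convergent_iff convergent_def by blast
  have "bounded_linear f"
    by (rule bounded_linear_intro[where K = K])
      (auto simp: add scaleR bound mult.commute scaleR_conv_of_real)
  then have "(\<lambda>n. \<Phi> (X n)) \<longlonglongrightarrow> \<Phi> z"
    unfolding \<Phi>_def
    by (intro tendsto_diff tendsto_mult tendsto_const tendsto_power tendsto_norm tendsto_Re z)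
      (rule bounded_linear.tendsto[OF _ z])
  moreover have "(\<lambda>n. m + 1 / real (Suc n)) \<longlonglongrightarrow> m + 0"
    by (rule tendsto_add[OF tendsto_const LIMSEQ_Suc[OF lim_1_over_n]])
  ultimately have "\<Phi> z \<le> m"
    using LIMSEQ_le[of "\<lambda>n. \<Phi> (X n)" "\<Phi> z" _ "m + 0"] X by (auto intro: less_imp_le)
  then have min: "\<Phi> z \<le> \<Phi> x" for x using m[of x] by linarith
  have re: "Re (f h) = Re (cinner z h)" for h
  proof -
    have "0 \<le> 2 * t * (Re (cinner z h) - Re (f h)) + t\<^sup>2 * (norm h)\<^sup>2" for t
    proof -
      have "cinner z (t *\<^sub>R h) = of_real t * cinner z h"
        by (metis cinner_scaleC_right scaleC_of_real)
      then show ?thesis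
        using min[of "z + t *\<^sub>R h"] norm_add_sq[of z "t *\<^sub>R h"]
        by (simp add: \<Phi>_def add scaleR power_mult_distrib algebra_simps)
    qed
    then show ?thesis using quadratic_nonneg_imp_zero by fastforce
  qed
  \<comment> \<open>Real parts agree on all vectors; testing with \<open>scaleC \<i> h\<close>
    recovers the imaginary parts.\<close>
  have "f h = cinner z h" for h
    using re[of h] re[of "scaleC \<i> h"] by (simp add: scale cinner_scaleC_right complex_eq_iff)
  then show ?thesis by blast
qed

lemma bounded_opsD:
  assumes "T \<in> bounded_ops"
  shows "bounded_linear T" "T (scaleC c x) = scaleC c (T x)"
    "T (x + y) = T x + T y" "T (x - y) = T x - T y" "T 0 = 0" "T (- x) = - T x"
    "norm (T x) \<le> onorm T * norm x" "T (sum g F) = (\<Sum>i\<in>F. T (g i))"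
    "T (sum_list (map k L)) = (\<Sum>p\<leftarrow>L. T (k p))"
proof -
  show bl: "bounded_linear T" and "T (scaleC c x) = scaleC c (T x)"
    using assms by (auto simp: bounded_ops_def)
  interpret bounded_linear T by fact
  show "T (x + y) = T x + T y" "T (x - y) = T x - T y" "T 0 = 0" "T (- x) = - T x"
    "norm (T x) \<le> onorm T * norm x" "T (sum g F) = (\<Sum>i\<in>F. T (g i))"
    by (auto simp: add diff zero neg onorm bl sum)
  show "T (sum_list (map k L)) = (\<Sum>p\<leftarrow>L. T (k p))"
    by (induction L) (auto simp: zero add)
qed

text \<open>The definite description in \<open>adj\<close> is meaningful: Riesz, applied to x |->
  <y, T x>, gives a candidate, and \<open>cinner_separates\<close> gives uniqueness.\<close>

lemma cinner_adj:
  assumes "T \<in> bounded_ops"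
  shows "cinner x (adj T y) = cinner (T x) y"
proof -
  have "\<exists>z. \<forall>x. cinner y (T x) = cinner z x"
  proof (rule riesz_representation[where K = "norm y * onorm T"])
    show "cmod (cinner y (T x)) \<le> norm y * onorm T * norm x" for x
      using norm_cinner_le[of y "T x"] mult_left_mono[OF bounded_opsD(7)[OF assms, of x], of "norm y"]
      by (simp add: mult.assoc)
  qed (auto simp: bounded_opsD[OF assms] cinner_add_right cinner_scaleC_right)
  then obtain z where "\<And>x. cinner y (T x) = cinner z x" by blast
  then have "\<And>x. cnj (cinner y (T x)) = cnj (cinner z x)" by simp
  then have z: "\<forall>x. cinner (T x) y = cinner x z"
    unfolding cinner_commute[symmetric] by blast
  have "\<forall>x. cinner (T x) y = cinner x (adj T y)"
    unfolding adj_def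
  proof (rule theI[of "\<lambda>z. \<forall>x. cinner (T x) y = cinner x z", OF z])
    show "w = z" if "\<forall>x. cinner (T x) y = cinner x w" for w
      by (rule cinner_separates) (use that z in simp)
  qed
  then show ?thesis by simp
qed

lemma cinner_adj_left:
  assumes "T \<in> bounded_ops"
  shows "cinner (adj T y) x = cinner y (T x)"
  unfolding cinner_commute[of "adj T y" x] cinner_commute[of y "T x"] cinner_adj[OF assms] ..

lemma adj_bounded_linear:
  assumes "T \<in> bounded_ops"
  shows "bounded_linear (adj T)"
proof (rule bounded_linear_intro[where K = "onorm T"])
  show "adj T (x + y) = adj T x + adj T y" for x y
    by (rule cinner_separates) (simp add: cinner_add_right cinner_adj[OF assms])
  show "adj T (r *\<^sub>R x) = r *\<^sub>R adj T x" for r x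
    unfolding scaleC_of_real[symmetric]
    by (rule cinner_separates) (simp add: cinner_scaleC_right cinner_adj[OF assms])
  show "norm (adj T x) \<le> norm x * onorm T" for x
  proof (rule norm_le_if_cinner_le)
    show "cmod (cinner z (adj T x)) \<le> norm x * onorm T * norm z" for z
      using norm_cinner_le[of "T z" x] mult_right_mono[OF bounded_opsD(7)[OF assms, of z], of "norm x"]
      by (simp add: cinner_adj[OF assms] algebra_simps)
  qed (simp add: onorm_pos_le bounded_opsD[OF assms])
qed

section \<open>The Haagerup norm\<close>

text \<open>Pairing the sum of the operators a \<open>adj a\<close> at x with x itself gives the sum
  of the ||\<open>adj a\<close> x||^2, so its operator norm bounds this quadratic form. Bounds of
  this shape add up over blocks.\<close>

lemma row_fac_bound:
  assumes "set L \<subseteq> bounded_ops \<times> bounded_ops"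
  shows "0 \<le> row_fac L" and "(\<Sum>(a, b)\<leftarrow>L. (norm (adj a x))\<^sup>2) \<le> (row_fac L)\<^sup>2 * (norm x)\<^sup>2"
proof -
  define T where "T = (\<lambda>x. \<Sum>(a, b)\<leftarrow>L. a (adj a x))"
  have bl: "bounded_linear T"
    unfolding T_def using assms
    by (induction L)
      (auto intro!: bounded_linear_add bounded_linear_compose[OF bounded_opsD(1) adj_bounded_linear])
  show "0 \<le> row_fac L"
    unfolding row_fac_def T_def[symmetric] by (simp add: onorm_pos_le bl)
  have sq: "(row_fac L)\<^sup>2 = onorm T"
    unfolding row_fac_def T_def[symmetric] by (simp add: onorm_pos_le bl)
  have "cinner x (T x) = complex_of_real (\<Sum>(a, b)\<leftarrow>L. (norm (adj a x))\<^sup>2)"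
    unfolding T_def using assms
  proof (induction L)
    case (Cons p L)
    then have "cinner x (fst p (adj (fst p) x)) = complex_of_real ((norm (adj (fst p) x))\<^sup>2)"
      using cinner_adj_left[of "fst p" x "adj (fst p) x"] cinner_self_norm[of "adj (fst p) x"] by auto
    then show ?case using Cons by (simp add: cinner_add_right split_def)
  qed simp
  moreover have "cmod (cinner x (T x)) \<le> norm x * (onorm T * norm x)"
    using norm_cinner_le[of x "T x"] mult_left_mono[OF onorm[OF bl, of x], of "norm x"] by simp
  ultimately have "\<bar>\<Sum>(a, b)\<leftarrow>L. (norm (adj a x))\<^sup>2\<bar> \<le> norm x * (onorm T * norm x)"
    by (metis norm_of_real)
  then show "(\<Sum>(a, b)\<leftarrow>L. (norm (adj a x))\<^sup>2) \<le> (row_fac L)\<^sup>2 * (norm x)\<^sup>2"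
    unfolding sq by (simp add: power2_eq_square algebra_simps)
qed

lemma col_fac_bound:
  assumes "set L \<subseteq> bounded_ops \<times> bounded_ops"
  shows "0 \<le> col_fac L" and "(\<Sum>(a, b)\<leftarrow>L. (norm (b x))\<^sup>2) \<le> (col_fac L)\<^sup>2 * (norm x)\<^sup>2"
proof -
  define T where "T = (\<lambda>x. \<Sum>(a, b)\<leftarrow>L. adj b (b x))"
  have bl: "bounded_linear T"
    unfolding T_def using assms
    by (induction L)
      (auto intro!: bounded_linear_add bounded_linear_compose[OF adj_bounded_linear bounded_opsD(1)])
  show "0 \<le> col_fac L"
    unfolding col_fac_def T_def[symmetric] by (simp add: onorm_pos_le bl)
  have sq: "(col_fac L)\<^sup>2 = onorm T"
    unfolding col_fac_def T_def[symmetric] by (simp add: onorm_pos_le bl)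
  have "cinner x (T x) = complex_of_real (\<Sum>(a, b)\<leftarrow>L. (norm (b x))\<^sup>2)"
    unfolding T_def using assms
  proof (induction L)
    case (Cons p L)
    then have "cinner x (adj (snd p) (snd p x)) = complex_of_real ((norm (snd p x))\<^sup>2)"
      using cinner_adj[of "snd p" x "snd p x"] cinner_self_norm[of "snd p x"] by auto
    then show ?case using Cons by (simp add: cinner_add_right split_def)
  qed simp
  moreover have "cmod (cinner x (T x)) \<le> norm x * (onorm T * norm x)"
    using norm_cinner_le[of x "T x"] mult_left_mono[OF onorm[OF bl, of x], of "norm x"] by simp
  ultimately have "\<bar>\<Sum>(a, b)\<leftarrow>L. (norm (b x))\<^sup>2\<bar> \<le> norm x * (onorm T * norm x)"
    by (metis norm_of_real)
  then show "(\<Sum>(a, b)\<leftarrow>L. (norm (b x))\<^sup>2) \<le> (col_fac L)\<^sup>2 * (norm x)\<^sup>2"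
    unfolding sq by (simp add: power2_eq_square algebra_simps)
qed

lemma norm_sum_cinner_le:
  fixes x y :: "'i \<Rightarrow> 'a::complex_inner"
  shows "cmod (\<Sum>p\<in>F. cinner (x p) (y p))
    \<le> sqrt (\<Sum>p\<in>F. (norm (x p))\<^sup>2) * sqrt (\<Sum>p\<in>F. (norm (y p))\<^sup>2)"
proof -
  have "cmod (\<Sum>p\<in>F. cinner (x p) (y p)) \<le> (\<Sum>p\<in>F. \<bar>norm (x p)\<bar> * \<bar>norm (y p)\<bar>)"
    by (rule order_trans[OF norm_sum]) (auto intro!: sum_mono norm_cinner_le)
  also have "\<dots> \<le> sqrt (\<Sum>p\<in>F. (norm (x p))\<^sup>2) * sqrt (\<Sum>p\<in>F. (norm (y p))\<^sup>2)"
    using L2_set_mult_ineq[of "\<lambda>p. norm (x p)" "\<lambda>p. norm (y p)" F] by (simp add: L2_set_def)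
  finally show ?thesis .
qed

text \<open>A row obeys the same bound as its adjoint column x |-> \<open>adj (a p) x\<close>: pair
  the image with x, move each \<open>a p\<close> across, and apply Cauchy-Schwarz.\<close>

lemma norm_row_apply_le:
  assumes "\<And>p. p \<in> F \<Longrightarrow> a p \<in> bounded_ops" and "0 \<le> \<alpha>"
    and "\<And>x. (\<Sum>p\<in>F. (norm (adj (a p) x))\<^sup>2) \<le> \<alpha>\<^sup>2 * (norm x)\<^sup>2"
  shows "norm (\<Sum>p\<in>F. a p (z p)) \<le> \<alpha> * sqrt (\<Sum>p\<in>F. (norm (z p))\<^sup>2)"
proof (rule norm_le_if_cinner_le)
  fix x
  have "cinner x (\<Sum>p\<in>F. a p (z p)) = (\<Sum>p\<in>F. cinner (adj (a p) x) (z p))"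
    by (simp add: cinner_sum_right cinner_adj_left assms(1) cong: sum.cong)
  also have "cmod \<dots> \<le> sqrt (\<Sum>p\<in>F. (norm (adj (a p) x))\<^sup>2) * sqrt (\<Sum>p\<in>F. (norm (z p))\<^sup>2)"
    by (rule norm_sum_cinner_le)
  also have "\<dots> \<le> sqrt (\<alpha>\<^sup>2 * (norm x)\<^sup>2) * sqrt (\<Sum>p\<in>F. (norm (z p))\<^sup>2)"
    by (intro mult_right_mono real_sqrt_le_mono assms(3)) (simp add: sum_nonneg)
  also have "\<dots> = \<alpha> * sqrt (\<Sum>p\<in>F. (norm (z p))\<^sup>2) * norm x"
    using assms(2) by (simp add: real_sqrt_mult)
  finally show "cmod (cinner x (\<Sum>p\<in>F. a p (z p))) \<le> \<alpha> * sqrt (\<Sum>p\<in>F. (norm (z p))\<^sup>2) * norm x" .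
qed (use assms(2) in \<open>simp add: sum_nonneg\<close>)

section \<open>Slices and their control by the Haagerup norm\<close>

lemma sum_list_conv_sum_nth: "(\<Sum>p\<leftarrow>L. f p) = (\<Sum>i<length L. f (L ! i))"
  by (simp add: sum_list_sum_nth atLeast0LessThan)

text \<open>This is the slice map id \<otimes> \<omega> for the vector functional \<omega>(b) =
  <\<eta>, b y>, evaluated at x.\<close>

definition slice :: "'h \<Rightarrow> 'h \<Rightarrow> (('h::chilbert_space \<Rightarrow> 'h) \<times> ('h \<Rightarrow> 'h)) list \<Rightarrow> 'h \<Rightarrow> 'h" where
  "slice \<eta> y L x = (\<Sum>(a, b)\<leftarrow>L. scaleC (cinner \<eta> (b y)) (a x))"

lemma cinner_slice: "cinner \<xi> (slice \<eta> y L x) = tens L \<xi> x \<eta> y"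
  by (simp add: slice_def tens_def cinner_sum_list_right cinner_scaleC_right split_def mult.commute)

lemma slice_cong_tens: "tens L = tens L' \<Longrightarrow> slice \<eta> y L x = slice \<eta> y L' x"
  by (rule cinner_separates) (simp add: cinner_slice)

text \<open>The slice is the row of left legs applied to the column of vectors \<omega>(b) x. The
  row factor bounds the row, and the column factor bounds the square sum of the b y, hence of that
  column.\<close>

lemma norm_slice_le:
  assumes L: "set L \<subseteq> bounded_ops \<times> bounded_ops"
  shows "norm (slice \<eta> y L x) \<le> row_fac L * col_fac L * (norm \<eta> * norm y * norm x)"
proof -
  let ?a = "\<lambda>i. fst (L ! i)" and ?b = "\<lambda>i. snd (L ! i)"
  let ?z = "\<lambda>i. scaleC (cinner \<eta> (?b i y)) x"
  have mem: "?a i \<in> bounded_ops" if "i < length L" for i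
    using L nth_mem[OF that] by auto
  have "slice \<eta> y L x = (\<Sum>i<length L. ?a i (?z i))"
    unfolding slice_def split_def sum_list_conv_sum_nth
    by (rule sum.cong) (auto simp: bounded_opsD(2)[OF mem])
  also have "norm \<dots> \<le> row_fac L * sqrt (\<Sum>i<length L. (norm (?z i))\<^sup>2)"
    using row_fac_bound[OF L] mem
    by (intro norm_row_apply_le) (auto simp: split_def sum_list_conv_sum_nth)
  also have "sqrt (\<Sum>i<length L. (norm (?z i))\<^sup>2) \<le> col_fac L * (norm \<eta> * norm y * norm x)"
  proof (rule real_le_lsqrt)
    have "(\<Sum>i<length L. (norm (?z i))\<^sup>2) \<le> (\<Sum>i<length L. (norm \<eta> * norm x)\<^sup>2 * (norm (?b i y))\<^sup>2)"
    proof (rule sum_mono)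
      fix i
      have "norm (?z i) \<le> (norm \<eta> * norm (?b i y)) * norm x"
        unfolding norm_scaleC by (intro mult_right_mono norm_cinner_le) auto
      then have "(norm (?z i))\<^sup>2 \<le> (norm \<eta> * norm (?b i y) * norm x)\<^sup>2" by (simp add: power_mono)
      then show "(norm (?z i))\<^sup>2 \<le> (norm \<eta> * norm x)\<^sup>2 * (norm (?b i y))\<^sup>2"
        by (simp add: power_mult_distrib algebra_simps)
    qed
    also have "\<dots> = (norm \<eta> * norm x)\<^sup>2 * (\<Sum>(a, b)\<leftarrow>L. (norm (b y))\<^sup>2)"
      by (simp add: sum_distrib_left split_def sum_list_conv_sum_nth)
    also have "\<dots> \<le> (norm \<eta> * norm x)\<^sup>2 * ((col_fac L)\<^sup>2 * (norm y)\<^sup>2)"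
      by (intro mult_left_mono col_fac_bound[OF L]) simp
    finally show "(\<Sum>i<length L. (norm (?z i))\<^sup>2) \<le> (col_fac L * (norm \<eta> * norm y * norm x))\<^sup>2"
      by (simp add: power_mult_distrib algebra_simps)
  qed (auto simp: col_fac_bound[OF L] sum_nonneg)
  finally show ?thesis
    using row_fac_bound(1)[OF L] by (simp add: mult_left_mono mult.assoc)
qed

text \<open>Slices depend only on the tensor, so the bound of \<open>norm_slice_le\<close> holds for
  every representation and passes to the infimum.\<close>

lemma norm_slice_le_haagerup:
  assumes A: "A \<subseteq> bounded_ops" and L: "set L \<subseteq> A \<times> A"
  shows "norm (slice \<eta> y L x) \<le> haagerup_norm A L * (norm \<eta> * norm y * norm x)"
proof -
  let ?S = "{row_fac L' * col_fac L' | L'. set L' \<subseteq> A \<times> A \<and> tens L' = tens L}"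
  let ?n = "norm \<eta> * norm y * norm x"
  have le: "norm (slice \<eta> y L x) \<le> s * ?n" if s: "s \<in> ?S" for s
  proof -
    obtain L' where L': "s = row_fac L' * col_fac L'" "set L' \<subseteq> A \<times> A" "tens L' = tens L"
      using s by blast
    have "set L' \<subseteq> bounded_ops \<times> bounded_ops" using L'(2) A by blast
    from norm_slice_le[OF this, of \<eta> y x] show ?thesis
      unfolding slice_cong_tens[OF L'(3)] L'(1) .
  qed
  have ne: "row_fac L * col_fac L \<in> ?S" using L by blast
  show ?thesis
  \<comment> \<open>Passing to the infimum divides by \<open>?n\<close>; in the degenerate case the
    representation L itself already gives the bound.\<close>
  proof (cases "?n = 0")
    case True
    show ?thesis using le[OF ne] unfolding True by simp
  next
    case False
    then have pos: "?n > 0" by (simp add: less_le)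
    have "norm (slice \<eta> y L x) / ?n \<le> haagerup_norm A L"
      unfolding haagerup_norm_def
      by (rule cInf_greatest) (use ne le pos in \<open>auto simp: pos_divide_le_eq\<close>)
    then show ?thesis using pos by (simp add: pos_divide_le_eq)
  qed
qed

lemma tens_append: "tens (L @ L') = (\<lambda>\<xi> x \<eta> y. tens L \<xi> x \<eta> y + tens L' \<xi> x \<eta> y)"
  by (simp add: tens_def)

text \<open>The multiplication map is well defined on tensors: if some right factor \<open>b\<close> is nonzero, a
  functional not vanishing at \<open>b\<close> expresses its partner \<open>a\<close> through the other left factors, which
  allows one summand to be eliminated.\<close>

lemma product_eq_0_if_tens_eq_0:
  assumes "\<And>a b. (a, b) \<in> set L \<Longrightarrow> a \<in> bounded_ops"
    and "\<And>\<xi> x \<eta> y. tens L \<xi> x \<eta> y = 0"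
  shows "(\<Sum>(a, b)\<leftarrow>L. a (b v)) = 0"
  using assms
proof (induction "length L" arbitrary: L)
  case (Suc n)
  from Suc.hyps(2) obtain a b L1 where L: "L = (a, b) # L1" by (metis length_Suc_conv surj_pair)
  have a: "a \<in> bounded_ops" using Suc.prems(1) L by auto
  have op: "fst p \<in> bounded_ops" if "p \<in> set L1" for p
    using Suc.prems(1)[of "fst p" "snd p"] that L by simp
  have t0: "cinner \<xi> (a x) * cinner \<eta> (b y) + tens L1 \<xi> x \<eta> y = 0" for \<xi> x \<eta> y
    using Suc.prems(2)[of \<xi> x \<eta> y] by (simp add: L tens_def)
  show ?case
  proof (cases "\<forall>y. b y = 0")
    case True
    have "(\<Sum>(a, b)\<leftarrow>L1. a (b v)) = 0"
    proof (rule Suc.hyps(1))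
      show "n = length L1" using Suc.hyps(2) L by simp
      show "tens L1 \<xi> x \<eta> y = 0" for \<xi> x \<eta> y using t0[of \<xi> x \<eta> y] True by simp
      show "a' \<in> bounded_ops" if "(a', b') \<in> set L1" for a' b' using op[OF that] by simp
    qed
    then show ?thesis using True bounded_opsD(5)[OF a] by (simp add: L)
  next
    case False
    then obtain y where y: "b y \<noteq> 0" by blast
    define \<beta> where "\<beta> = cinner (b y) (b y)"
    have \<beta>: "\<beta> \<noteq> 0" using y by (simp add: \<beta>_def cinner_self_norm)
    \<comment> \<open>\<open>g p\<close> is the value at \<open>snd p\<close> of the functional <b
      y, . y>, normalised to be 1 at b. Applied to the right leg of the vanishing tensor, it
      expresses -a through the other left factors (\<open>ga\<close>).\<close>
    define g where "g p = cinner (b y) (snd p y) / \<beta>" for p :: "('a \<Rightarrow> 'a) \<times> ('a \<Rightarrow> 'a)"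
    have g_sum: "(\<Sum>p\<leftarrow>L1. cinner \<xi> (fst p x) * g p) = - cinner \<xi> (a x)" for \<xi> x
    proof -
      have "(\<Sum>p\<leftarrow>L1. cinner \<xi> (fst p x) * g p) = tens L1 \<xi> x (b y) y / \<beta>"
        unfolding tens_def g_def split_def by (induction L1) (auto simp: add_divide_distrib)
      moreover have "tens L1 \<xi> x (b y) y = - cinner \<xi> (a x) * \<beta>"
        using t0[of \<xi> x "b y" y] by (simp add: \<beta>_def eq_neg_iff_add_eq_0 add.commute)
      ultimately show ?thesis using \<beta> by simp
    qed
    have ga: "(\<Sum>p\<leftarrow>L1. scaleC (g p) (fst p x)) = - a x" for x
      by (rule cinner_separates)
        (simp add: cinner_sum_list_right cinner_scaleC_right cinner_minus_right g_sum[symmetric] mult.commute)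
    \<comment> \<open>Substituting for a turns the tensor into a shorter sum with the same left
      factors and right factors corrected by multiples of b, which the induction hypothesis
      covers.\<close>
    define L2 where "L2 = map (\<lambda>p. (fst p, \<lambda>z. snd p z - scaleC (g p) (b z))) L1"
    have "(\<Sum>(a, b)\<leftarrow>L2. a (b v)) = 0"
    proof (rule Suc.hyps(1))
      show "n = length L2" using Suc.hyps(2) L by (simp add: L2_def)
      show "a' \<in> bounded_ops" if "(a', b') \<in> set L2" for a' b' using that op by (auto simp: L2_def)
      show "tens L2 \<xi> x \<eta> z = 0" for \<xi> x \<eta> z
      proof -
        have "tens L2 \<xi> x \<eta> z
            = tens L1 \<xi> x \<eta> z - (\<Sum>p\<leftarrow>L1. cinner \<xi> (fst p x) * g p) * cinner \<eta> (b z)"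
          unfolding tens_def L2_def
          by (induction L1) (auto simp: cinner_diff_right cinner_scaleC_right algebra_simps)
        then show ?thesis using t0[of \<xi> x \<eta> z] by (simp add: g_sum add.commute)
      qed
    qed
    also have "(\<Sum>(a, b)\<leftarrow>L2. a (b v))
        = (\<Sum>(a, b)\<leftarrow>L1. a (b v)) - (\<Sum>p\<leftarrow>L1. scaleC (g p) (fst p (b v)))"
      unfolding L2_def using op
      by (induction L1) (auto simp: bounded_opsD)
    finally show ?thesis unfolding ga by (simp add: L add.commute)
  qed
qed simp

lemma product_cong_tens:
  assumes "set L \<subseteq> bounded_ops \<times> bounded_ops" "set L' \<subseteq> bounded_ops \<times> bounded_ops"
    and "tens L = tens L'"
  shows "(\<Sum>(a, b)\<leftarrow>L. a (b v)) = (\<Sum>(a, b)\<leftarrow>L'. a (b v))"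
proof -
  let ?M = "map (\<lambda>p. (fst p, \<lambda>x. - snd p x)) L'"
  have "tens ?M = (\<lambda>\<xi> x \<eta> y. - tens L' \<xi> x \<eta> y)"
    unfolding tens_def by (induction L') (auto simp: cinner_minus_right fun_eq_iff)
  then have "(\<Sum>(a, b)\<leftarrow>L @ ?M. a (b v)) = 0"
    using assms by (intro product_eq_0_if_tens_eq_0) (auto simp: tens_append)
  moreover have "(\<Sum>(a, b)\<leftarrow>?M. a (b v)) = - (\<Sum>(a, b)\<leftarrow>L'. a (b v))"
    using assms(2) by (induction L') (auto simp: bounded_opsD)
  ultimately show ?thesis by simp
qed

text \<open>Some representation has a product of factors below t^2. Multiplying left legs by s and
  right legs by 1/s keeps the tensor and brings both factors to at most t.\<close>

lemma balanced_representation: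
  assumes A: "unital_subalgebra A" and L: "set L \<subseteq> A \<times> A" and t: "t > 0"
    and small: "haagerup_norm A L < t\<^sup>2"
  shows "\<exists>L'. set L' \<subseteq> A \<times> A \<and> tens L' = tens L \<and>
    (\<forall>x. (\<Sum>(a, b)\<leftarrow>L'. (norm (adj a x))\<^sup>2) \<le> t\<^sup>2 * (norm x)\<^sup>2) \<and>
    (\<forall>x. (\<Sum>(a, b)\<leftarrow>L'. (norm (b x))\<^sup>2) \<le> t\<^sup>2 * (norm x)\<^sup>2)"
proof -
  have AB: "A \<subseteq> bounded_ops" and Asc: "\<And>c T. T \<in> A \<Longrightarrow> (\<lambda>x. scaleC c (T x)) \<in> A"
    using A by (auto simp: unital_subalgebra_def)
  have "{row_fac L' * col_fac L' | L'. set L' \<subseteq> A \<times> A \<and> tens L' = tens L} \<noteq> {}"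
    using L by blast
  from cInf_lessD[OF this small[unfolded haagerup_norm_def]]
  obtain M where M: "set M \<subseteq> A \<times> A" "tens M = tens L" and lt: "row_fac M * col_fac M < t\<^sup>2"
    by blast
  have MB: "set M \<subseteq> bounded_ops \<times> bounded_ops" using M(1) AB by blast
  note R = row_fac_bound[OF MB] and C = col_fac_bound[OF MB]
  \<comment> \<open>If the row factor is nonzero, s = t / \<open>row_fac M\<close> makes it exactly
    t. If it is zero, any large s will do.\<close>
  have "\<exists>s>0. s * row_fac M \<le> t \<and> col_fac M / s \<le> t"
  proof (cases "row_fac M = 0")
    case True
    have "col_fac M / ((col_fac M + 1) / t) \<le> t"
      using t C(1) by (simp add: field_simps)
    then show ?thesis
      using t C(1) True by (intro exI[of _ "(col_fac M + 1) / t"]) auto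
  next
    case False
    then have "row_fac M > 0" using R(1) by simp
    then show ?thesis
      using t lt by (intro exI[of _ "t / row_fac M"]) (auto simp: field_simps power2_eq_square)
  qed
  then obtain s where s: "s > 0" "s * row_fac M \<le> t" "col_fac M / s \<le> t" by blast
  let ?f = "\<lambda>p. (\<lambda>x. scaleC (of_real s) (fst p x), \<lambda>x. scaleC (of_real (1 / s)) (snd p x))"
  let ?L' = "map ?f M"
  have "set ?L' \<subseteq> A \<times> A" using M(1) Asc by auto
  moreover have "tens ?L' = tens L"
  proof -
    have "tens ?L' = tens M"
      unfolding tens_def using s(1)
      by (auto simp: fun_eq_iff cinner_scaleC_right split_def o_def)
    then show ?thesis using M(2) by simp
  qed
  moreover have "(\<Sum>(a, b)\<leftarrow>?L'. (norm (adj a x))\<^sup>2) \<le> t\<^sup>2 * (norm x)\<^sup>2" for x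
  proof -
    have adj: "adj (\<lambda>x. scaleC (of_real s) (fst p x)) x = scaleC (of_real s) (adj (fst p) x)"
      if "p \<in> set M" for p
    proof -
      have p: "fst p \<in> A" using that M(1) by auto
      then have "fst p \<in> bounded_ops" "(\<lambda>x. scaleC (of_real s) (fst p x)) \<in> bounded_ops"
        using AB Asc[OF p] by auto
      then show ?thesis
        by (intro cinner_separates[of "adj (\<lambda>x. scaleC (of_real s) (fst p x)) x"])
          (simp add: cinner_adj cinner_scaleC_left cinner_scaleC_right)
    qed
    have "(\<Sum>(a, b)\<leftarrow>?L'. (norm (adj a x))\<^sup>2) = (\<Sum>p\<leftarrow>M. s\<^sup>2 * (norm (adj (fst p) x))\<^sup>2)"
      using s(1) adj
      by (auto simp: o_def norm_scaleC power_mult_distrib intro!: arg_cong[where f = sum_list])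
    also have "\<dots> = s\<^sup>2 * (\<Sum>(a, b)\<leftarrow>M. (norm (adj a x))\<^sup>2)"
      by (simp add: sum_list_const_mult split_def)
    also have "\<dots> \<le> s\<^sup>2 * ((row_fac M)\<^sup>2 * (norm x)\<^sup>2)" by (intro mult_left_mono R) simp
    also have "\<dots> = (s * row_fac M)\<^sup>2 * (norm x)\<^sup>2" by (simp add: power_mult_distrib)
    also have "\<dots> \<le> t\<^sup>2 * (norm x)\<^sup>2" using s R(1) by (intro mult_right_mono power_mono) auto
    finally show ?thesis .
  qed
  moreover have "(\<Sum>(a, b)\<leftarrow>?L'. (norm (b x))\<^sup>2) \<le> t\<^sup>2 * (norm x)\<^sup>2" for x
  proof -
    have "(\<Sum>(a, b)\<leftarrow>?L'. (norm (b x))\<^sup>2) = (\<Sum>p\<leftarrow>M. (1/s)\<^sup>2 * (norm (snd p x))\<^sup>2)"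
      using s(1) by (auto simp: o_def norm_scaleC norm_divide power_mult_distrib power_divide)
    also have "\<dots> = (1/s)\<^sup>2 * (\<Sum>(a, b)\<leftarrow>M. (norm (b x))\<^sup>2)"
      by (simp add: sum_list_const_mult split_def)
    also have "\<dots> \<le> (1/s)\<^sup>2 * ((col_fac M)\<^sup>2 * (norm x)\<^sup>2)" by (intro mult_left_mono C) simp
    also have "\<dots> = (col_fac M / s)\<^sup>2 * (norm x)\<^sup>2" by (simp add: power_divide)
    also have "\<dots> \<le> t\<^sup>2 * (norm x)\<^sup>2" using s C(1) by (intro mult_right_mono power_mono) auto
    finally show ?thesis .
  qed
  ultimately show ?thesis by blast
qed

text \<open>Passing to the kernel of one functional lowers the dimension by at most one, so one
  element outside that kernel is added to the spanning set. The induction varies \<open>A\<close>,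
  which shrinks to the kernel.\<close>

lemma finite_dim_ops_if_functionals_separate:
  assumes "finite J"
    and "\<And>S T. S \<in> A \<Longrightarrow> T \<in> A \<Longrightarrow> (\<lambda>x. S x + T x) \<in> A"
    and "\<And>c T. T \<in> A \<Longrightarrow> (\<lambda>x. scaleC c (T x)) \<in> A"
    and "\<And>j S T. S \<in> A \<Longrightarrow> T \<in> A \<Longrightarrow> \<phi> j (\<lambda>x. S x + T x) = \<phi> j S + \<phi> j T"
    and "\<And>j c T. T \<in> A \<Longrightarrow> \<phi> j (\<lambda>x. scaleC c (T x)) = c * \<phi> j T"
    and "\<And>T. T \<in> A \<Longrightarrow> (\<And>j. j \<in> J \<Longrightarrow> \<phi> j T = 0) \<Longrightarrow> T = (\<lambda>x. 0)"
  shows "finite_dim_ops A"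
  using assms
proof (induction J arbitrary: A rule: finite_induct)
  case empty
  then show ?case unfolding finite_dim_ops_def by (intro exI[of _ "{}"]) auto
next
  case (insert j J)
  note add = insert.prems(1) and scale = insert.prems(2)
    and \<phi>_add = insert.prems(3) and \<phi>_scale = insert.prems(4) and sep = insert.prems(5)
  define A0 where "A0 = {T \<in> A. \<phi> j T = 0}"
  have "finite_dim_ops A0"
  proof (rule insert.IH)
    show "T = (\<lambda>x. 0)" if "T \<in> A0" "\<And>i. i \<in> J \<Longrightarrow> \<phi> i T = 0" for T
      by (rule sep) (use that in \<open>auto simp: A0_def\<close>)
  qed (use add scale \<phi>_add \<phi>_scale in \<open>auto simp: A0_def\<close>)
  then obtain F where F: "finite F" "F \<subseteq> A0"
    "\<And>T. T \<in> A0 \<Longrightarrow> \<exists>c. T = (\<lambda>x. \<Sum>f\<in>F. scaleC (c f) (f x))"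
    unfolding finite_dim_ops_def by blast
  show ?case
  proof (cases "A0 = A")
    case True
    then show ?thesis using \<open>finite_dim_ops A0\<close> by simp
  next
    case False
    then obtain T0 where T0: "T0 \<in> A" "\<phi> j T0 \<noteq> 0" by (auto simp: A0_def)
    then have "T0 \<notin> F" using F(2) by (auto simp: A0_def)
    have "\<exists>c. T = (\<lambda>x. \<Sum>f\<in>insert T0 F. scaleC (c f) (f x))" if T: "T \<in> A" for T
    proof -
      \<comment> \<open>This k puts T - k T0 into the kernel of \<open>\<phi> j\<close>.\<close>
      define k where "k = \<phi> j T / \<phi> j T0"
      define S where "S = (\<lambda>x. T x + scaleC (- k) (T0 x))"
      have "S \<in> A0"
        unfolding A0_def S_def
        using T T0 add scale \<phi>_add[OF T scale[OF T0(1)]] \<phi>_scale[OF T0(1)] by (simp add: k_def)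
      then obtain c where c: "S = (\<lambda>x. \<Sum>f\<in>F. scaleC (c f) (f x))" using F(3) by blast
      have "T x = (\<Sum>f\<in>insert T0 F. scaleC ((c(T0 := k)) f) (f x))" for x
      proof -
        have "(\<Sum>f\<in>F. scaleC ((c(T0 := k)) f) (f x)) = S x"
          unfolding c using \<open>T0 \<notin> F\<close> by (intro sum.cong) auto
        then show ?thesis using F(1) \<open>T0 \<notin> F\<close> by (simp add: S_def scaleC_minus_left)
      qed
      then show ?thesis by blast
    qed
    moreover have "finite (insert T0 F)" "insert T0 F \<subseteq> A" using F T0 by (auto simp: A0_def)
    ultimately show ?thesis unfolding finite_dim_ops_def by blast
  qed
qed

section \<open>Square-summable families\<close>

text \<open>Elements of l2 over an arbitrary index type stay plain functions guarded by this
  predicate, since the coordinate sequences \<open>pairing b G\<close> arise as functions of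
  k.\<close>

definition sq_summable :: "('i \<Rightarrow> complex) \<Rightarrow> bool" where
  "sq_summable f \<longleftrightarrow> (\<lambda>k. (cmod (f k))\<^sup>2) summable_on UNIV"

definition l2_inner :: "('i \<Rightarrow> complex) \<Rightarrow> ('i \<Rightarrow> complex) \<Rightarrow> complex" where
  "l2_inner f g = (\<Sum>\<^sub>\<infinity>k. cnj (f k) * g k)"

definition l2_sq :: "('i \<Rightarrow> complex) \<Rightarrow> real" where
  "l2_sq f = (\<Sum>\<^sub>\<infinity>k. (cmod (f k))\<^sup>2)"

lemma l2_sq_nonneg: "0 \<le> l2_sq f"
  unfolding l2_sq_def by (rule infsum_nonneg) simp

lemma has_sum_l2_sq: "sq_summable f \<Longrightarrow> ((\<lambda>k. (cmod (f k))\<^sup>2) has_sum l2_sq f) UNIV"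
  unfolding sq_summable_def l2_sq_def by simp

lemma has_sum_l2_inner:
  assumes "sq_summable f" "sq_summable g"
  shows "((\<lambda>k. cnj (f k) * g k) has_sum l2_inner f g) UNIV"
proof -
  have "(\<lambda>k. (cmod (f k))\<^sup>2 + (cmod (g k))\<^sup>2) summable_on UNIV"
    using assms unfolding sq_summable_def by (rule summable_on_add)
  moreover have "norm (cnj (f k) * g k) \<le> (cmod (f k))\<^sup>2 + (cmod (g k))\<^sup>2" for k
  proof -
    have "0 \<le> (cmod (f k) - cmod (g k))\<^sup>2" "0 \<le> (cmod (f k))\<^sup>2" "0 \<le> (cmod (g k))\<^sup>2" by simp_all
    then show ?thesis unfolding norm_mult complex_mod_cnj power2_diff by linarith
  qed
  ultimately have "(\<lambda>k. norm (cnj (f k) * g k)) summable_on UNIV"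
    by (rule summable_on_comparison_test) auto
  then show ?thesis unfolding l2_inner_def by (simp add: abs_summable_summable)
qed

lemma sq_summable_bound:
  assumes "\<And>F. finite F \<Longrightarrow> (\<Sum>k\<in>F. (cmod (f k))\<^sup>2) \<le> C"
  shows "sq_summable f" and "l2_sq f \<le> C"
proof -
  show f: "sq_summable f"
    unfolding sq_summable_def
    by (rule nonneg_bdd_above_summable_on) (use assms in \<open>auto intro!: bdd_aboveI2\<close>)
  show "l2_sq f \<le> C"
    unfolding l2_sq_def
    by (rule infsum_le_finite_sums) (use f assms in \<open>auto simp: sq_summable_def\<close>)
qed

lemma sq_summable_cmult: "sq_summable f \<Longrightarrow> sq_summable (\<lambda>k. c * f k)"
  unfolding sq_summable_def norm_mult power_mult_distrib by (rule summable_on_cmult_right)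

lemma sq_summable_add:
  assumes "sq_summable f" "sq_summable g"
  shows "sq_summable (\<lambda>k. f k + g k)"
proof -
  have "(\<lambda>k. 2 * ((cmod (f k))\<^sup>2 + (cmod (g k))\<^sup>2)) summable_on UNIV"
    using assms unfolding sq_summable_def by (intro summable_on_cmult_right summable_on_add)
  moreover have "(cmod (f k + g k))\<^sup>2 \<le> 2 * ((cmod (f k))\<^sup>2 + (cmod (g k))\<^sup>2)" for k
  proof -
    have "(cmod (f k + g k))\<^sup>2 \<le> (cmod (f k) + cmod (g k))\<^sup>2"
      by (intro power_mono norm_triangle_ineq) simp
    moreover have "0 \<le> (cmod (f k) - cmod (g k))\<^sup>2" by simp
    ultimately show ?thesis unfolding power2_diff power2_sum by argo
  qed
  ultimately show ?thesis
    unfolding sq_summable_def by (rule summable_on_comparison_test) auto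
qed

lemma sq_summable_diff:
  assumes "sq_summable f" "sq_summable g"
  shows "sq_summable (\<lambda>k. f k - g k)"
  using sq_summable_add[OF assms(1) sq_summable_cmult[OF assms(2), of "-1"]] by simp

lemma l2_inner_cmult_right: "l2_inner f (\<lambda>k. c * g k) = c * l2_inner f g"
  unfolding l2_inner_def infsum_cmult_right'[symmetric] by (simp add: algebra_simps)

lemma l2_inner_diff_right:
  assumes "sq_summable f" "sq_summable g" "sq_summable h"
  shows "l2_inner f (\<lambda>k. g k - h k) = l2_inner f g - l2_inner f h"
proof -
  have "((\<lambda>k. cnj (f k) * g k + (-1) * (cnj (f k) * h k)) has_sum (l2_inner f g + (-1) * l2_inner f h)) UNIV"
    by (intro has_sum_add has_sum_cmult_right has_sum_l2_inner assms)
  then show ?thesis by (simp add: l2_inner_def infsumI algebra_simps)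
qed

lemma l2_sq_diff:
  assumes "sq_summable f" "sq_summable g"
  shows "l2_sq (\<lambda>k. f k - g k) = l2_sq f - 2 * Re (l2_inner f g) + l2_sq g"
proof -
  have "((\<lambda>k. (cmod (f k))\<^sup>2 + (-2) * Re (cnj (f k) * g k) + (cmod (g k))\<^sup>2)
      has_sum (l2_sq f + (-2) * Re (l2_inner f g) + l2_sq g)) UNIV"
    by (intro has_sum_add has_sum_cmult_right has_sum_l2_sq assms
        has_sum_bounded_linear[OF bounded_linear_Re] has_sum_l2_inner)
  moreover have "(cmod (f k - g k))\<^sup>2 = (cmod (f k))\<^sup>2 + (-2) * Re (cnj (f k) * g k) + (cmod (g k))\<^sup>2" for k
    unfolding cmod_power2 by (simp add: power2_eq_square algebra_simps)
  ultimately show ?thesis by (simp add: l2_sq_def infsumI)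
qed

lemma l2_sq_cmult: "l2_sq (\<lambda>k. c * f k) = (cmod c)\<^sup>2 * l2_sq f"
  unfolding l2_sq_def norm_mult power_mult_distrib by (simp add: infsum_cmult_right')

text \<open>A near-minimiser of the distance replaces the orthogonal projection onto the closure
  of \<open>E\<close>; no completeness is needed.\<close>

lemma almost_orthogonal_approximation:
  assumes E_sq: "\<And>f. f \<in> E \<Longrightarrow> sq_summable f" and E0: "(\<lambda>k. 0) \<in> E"
    and E_add: "\<And>f g. f \<in> E \<Longrightarrow> g \<in> E \<Longrightarrow> (\<lambda>k. f k + g k) \<in> E"
    and E_scale: "\<And>f c. f \<in> E \<Longrightarrow> (\<lambda>k. c * f k) \<in> E"
    and e: "sq_summable e" "l2_sq e = 1" and \<epsilon>: "0 < \<epsilon>" "\<epsilon> \<le> 1"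
  shows "\<exists>f\<in>E. l2_sq f \<le> 9 \<and>
    (\<forall>g\<in>E. cmod (l2_inner (\<lambda>k. e k - f k) g) \<le> \<epsilon> * sqrt (l2_sq g))"
proof -
  let ?D = "\<lambda>f. l2_sq (\<lambda>k. e k - f k)"
  define m where "m = Inf (?D ` E)"
  have bdd: "bdd_below (?D ` E)" by (rule bdd_belowI2[of _ 0]) (rule l2_sq_nonneg)
  have m: "m \<le> ?D f" if "f \<in> E" for f
    unfolding m_def using that bdd by (simp add: cInf_lower)
  \<comment> \<open>The excess over the infimum is \<epsilon>^2 because optimising the variation
    below turns it into P^2 <= \<epsilon>^2 q.\<close>
  have "\<exists>y\<in>?D ` E. y < m + \<epsilon>\<^sup>2"
    by (rule cInf_lessD) (use E0 \<epsilon> in \<open>auto simp: m_def\<close>)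
  then obtain f where f: "f \<in> E" "?D f < m + \<epsilon>\<^sup>2" by blast
  let ?r = "\<lambda>k. e k - f k"
  have r: "sq_summable ?r" using sq_summable_diff e f E_sq by blast
  have orth: "cmod (l2_inner ?r g) \<le> \<epsilon> * sqrt (l2_sq g)" if g: "g \<in> E" for g
  proof -
    define P where "P = cmod (l2_inner ?r g)"
    define q where "q = l2_sq g"
    have q0: "0 \<le> q" by (simp add: q_def l2_sq_nonneg)
    \<comment> \<open>The phase u rotates the inner product to its modulus P, so that a real
      parameter t suffices below.\<close>
    obtain u where u: "cmod u = 1" "u * l2_inner ?r g = of_real P"
    proof (cases "l2_inner ?r g = 0")
      case True
      then show ?thesis using that[of 1] by (simp add: P_def)
    next
      case False
      have "of_real P * of_real P = l2_inner ?r g * cnj (l2_inner ?r g)"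
        using complex_norm_square[of "l2_inner ?r g"] by (simp add: P_def power2_eq_square)
      then have "cnj (l2_inner ?r g) / of_real P * l2_inner ?r g = of_real P"
        using False by (simp add: P_def field_simps)
      moreover have "cmod (cnj (l2_inner ?r g) / of_real P) = 1"
        using False by (simp add: P_def norm_divide)
      ultimately show ?thesis by (rule that[rotated])
    qed
    \<comment> \<open>Moving from f to f + t u g stays in E and so lowers the squared distance by
      less than \<epsilon>^2. The best t is P/q; for q = 0, t = \<epsilon>^2/P refutes P >
      0.\<close>
    have var: "2 * t * P - t\<^sup>2 * q < \<epsilon>\<^sup>2" for t :: real
    proof -
      let ?h = "\<lambda>k. (of_real t * u) * g k"
      have h: "?h \<in> E" using E_scale g by blast
      have "m \<le> l2_sq (\<lambda>k. ?r k - ?h k)"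
        using m[OF E_add[OF f(1) h]] by (simp add: algebra_simps)
      also have "\<dots> = ?D f - 2 * Re (l2_inner ?r ?h) + l2_sq ?h"
        by (rule l2_sq_diff[OF r E_sq[OF h]])
      also have "l2_inner ?r ?h = of_real (t * P)"
        unfolding l2_inner_cmult_right by (simp add: u(2) mult.assoc)
      also have "l2_sq ?h = t\<^sup>2 * q"
        unfolding l2_sq_cmult q_def by (simp add: norm_mult u(1))
      finally show ?thesis using f(2) by simp
    qed
    have "P\<^sup>2 \<le> \<epsilon>\<^sup>2 * q"
    proof (cases "q = 0")
      case True
      have "P \<le> 0"
      proof (rule ccontr)
        assume "\<not> P \<le> 0"
        then show False using var[of "\<epsilon>\<^sup>2 / P"] True \<epsilon> by simp
      qed
      then show ?thesis using True by (simp add: P_def)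
    next
      case False
      then have "P\<^sup>2 / q < \<epsilon>\<^sup>2"
        using var[of "P / q"] by (simp add: power2_eq_square field_simps)
      then show ?thesis using False q0 by (simp add: field_simps)
    qed
    then have "P\<^sup>2 \<le> (\<epsilon> * sqrt q)\<^sup>2" using q0 by (simp add: power_mult_distrib)
    then show ?thesis
      unfolding P_def q_def by (rule power2_le_imp_le) (use \<epsilon> l2_sq_nonneg[of g] in simp)
  qed
  \<comment> \<open>Comparison with 0 in E gives ||e - f||^2 < 2, hence ||f||^2 <= 2 + 2 ||e - f||^2
    < 6. The weaker 9 is a square, whose root 3 enters later estimates.\<close>
  have "l2_sq f \<le> 9"
  proof -
    have "?D f < 1 + \<epsilon>\<^sup>2" using f(2) m[OF E0] e(2) by simp
    moreover have "\<epsilon>\<^sup>2 \<le> 1" using \<epsilon> by (simp add: power_le_one)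
    moreover have "l2_sq f = 1 - 2 * Re (l2_inner e ?r) + ?D f"
      using l2_sq_diff[OF e(1) r] e(2) by simp
    moreover have "- (2 * Re (l2_inner e ?r)) \<le> 1 + ?D f"
    proof -
      have "l2_sq (\<lambda>k. e k - (-1) * ?r k) = 1 - 2 * Re (l2_inner e (\<lambda>k. (-1) * ?r k)) + l2_sq (\<lambda>k. (-1) * ?r k)"
        using l2_sq_diff[OF e(1) sq_summable_cmult[OF r, of "-1"]] e(2) by simp
      then have "0 \<le> 1 + 2 * Re (l2_inner e ?r) + ?D f"
        using l2_sq_nonneg[of "\<lambda>k. e k - (-1) * ?r k"]
        unfolding l2_inner_cmult_right l2_sq_cmult by simp
      then show ?thesis by linarith
    qed
    ultimately show ?thesis by linarith
  qed
  then show ?thesis using f(1) orth by blast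
qed

section \<open>Infinite sums and the approximation of row-column products\<close>

lemma has_sum_sum:
  fixes f :: "'j \<Rightarrow> 'i \<Rightarrow> 'a::topological_comm_monoid_add"
  assumes "\<And>j. j \<in> M \<Longrightarrow> (f j has_sum s j) I"
  shows "((\<lambda>k. \<Sum>j\<in>M. f j k) has_sum (\<Sum>j\<in>M. s j)) I"
  using assms by (induction M rule: infinite_finite_induct) (auto intro: has_sum_add)

lemma norm_has_sum_le:
  assumes "(f has_sum s) I" "\<And>F. finite F \<Longrightarrow> F \<subseteq> I \<Longrightarrow> norm (sum f F) \<le> C"
  shows "norm s \<le> C"
proof (rule tendsto_le[OF _ tendsto_const])
  show "((\<lambda>F. norm (sum f F)) \<longlongrightarrow> norm s) (finite_subsets_at_top I)"
    using assms(1) unfolding has_sum_def by (rule tendsto_norm)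
  show "\<forall>\<^sub>F F in finite_subsets_at_top I. norm (sum f F) \<le> C"
    using assms(2) by (auto intro: eventually_finite_subsets_at_top_weakI)
qed simp

text \<open>A list of vector pairs stands for a combination g of vector functionals: concatenation
  adds, and scalars go into the left vectors. Hence the sequences for all lists form a linear
  space.\<close>

definition pairing :: "('i \<Rightarrow> 'h::chilbert_space \<Rightarrow> 'h) \<Rightarrow> ('h \<times> 'h) list \<Rightarrow> 'i \<Rightarrow> complex" where
  "pairing b G k = (\<Sum>(\<eta>, y)\<leftarrow>G. cinner \<eta> (b k y))"

text \<open>Let \<open>E\<close> be the space of sequences \<open>(g(b\<^sub>k))\<^sub>k\<close> with \<open>g\<close> a combination of vector functionals,
  let \<open>Q\<close> be the projection of \<open>\<ell>\<^sup>2\<close> onto the orthogonal complement of \<open>E\<close>, and \<open>z = (Q \<otimes> 1) b|\<^sub>M v\<close>.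
  As \<open>(Q \<otimes> 1) b v = 0\<close>, we have \<open>\<parallel>z\<parallel>\<^sup>2 = \<langle>z, b|\<^sub>M v\<rangle> = - \<langle>z, b|\<^bsub>-M\<^esub> v\<rangle> \<le> \<parallel>z\<parallel> \<delta> \<parallel>v\<parallel>\<close>. Below this is carried out
  with approximations \<open>r\<^sub>i\<close> to \<open>Q e\<^sub>i\<close>.\<close>

lemma row_column_approximation:
  fixes a b :: "'i \<Rightarrow> 'h::chilbert_space \<Rightarrow> 'h"
  assumes a_op: "\<And>p. a p \<in> bounded_ops" and b_op: "\<And>p. b p \<in> bounded_ops"
    and M: "finite M" and \<alpha>: "0 \<le> \<alpha>" and \<beta>: "0 \<le> \<beta>" and \<delta>: "0 < \<delta>"
    and row: "\<And>F x. finite F \<Longrightarrow> (\<Sum>p\<in>F. (norm (adj (a p) x))\<^sup>2) \<le> \<alpha>\<^sup>2 * (norm x)\<^sup>2"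
    and col: "\<And>F x. finite F \<Longrightarrow> (\<Sum>p\<in>F. (norm (b p x))\<^sup>2) \<le> \<beta>\<^sup>2 * (norm x)\<^sup>2"
    and tail: "\<And>F x. finite F \<Longrightarrow> F \<inter> M = {} \<Longrightarrow> (\<Sum>p\<in>F. (norm (b p x))\<^sup>2) \<le> \<delta>\<^sup>2 * (norm x)\<^sup>2"
  shows "\<exists>G. \<forall>F v. finite F \<longrightarrow> M \<subseteq> F \<longrightarrow>
    norm ((\<Sum>i\<in>M. a i (b i v)) - (\<Sum>i\<in>M. \<Sum>k\<in>F. scaleC (pairing b (G i) k) (a k (b i v))))
      \<le> 2 * \<alpha> * \<delta> * norm v"
proof -
  define E where "E = range (pairing b)"
  have vec: "(\<Sum>k\<in>F. (cmod (cinner \<eta> (b k y)))\<^sup>2) \<le> (norm \<eta> * (\<beta> * norm y))\<^sup>2" if "finite F" for \<eta> y F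
  proof -
    have "(\<Sum>k\<in>F. (cmod (cinner \<eta> (b k y)))\<^sup>2) \<le> (\<Sum>k\<in>F. (norm \<eta>)\<^sup>2 * (norm (b k y))\<^sup>2)"
    proof (rule sum_mono)
      fix k
      have "(cmod (cinner \<eta> (b k y)))\<^sup>2 \<le> (norm \<eta> * norm (b k y))\<^sup>2"
        by (intro power_mono norm_cinner_le) simp
      then show "(cmod (cinner \<eta> (b k y)))\<^sup>2 \<le> (norm \<eta>)\<^sup>2 * (norm (b k y))\<^sup>2"
        by (simp add: power_mult_distrib)
    qed
    also have "\<dots> \<le> (norm \<eta>)\<^sup>2 * (\<beta>\<^sup>2 * (norm y)\<^sup>2)"
      unfolding sum_distrib_left[symmetric] using col[OF that] by (intro mult_left_mono) auto
    finally show ?thesis by (simp add: power_mult_distrib)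
  qed
  have vec_E: "(\<lambda>k. cinner \<eta> (b k y)) \<in> E" for \<eta> y
  proof -
    have "(\<lambda>k. cinner \<eta> (b k y)) = pairing b [(\<eta>, y)]" by (simp add: pairing_def fun_eq_iff)
    then show ?thesis by (simp add: E_def)
  qed
  have pairing_sq: "sq_summable (pairing b G)" for G
  proof (induction G)
    case Nil
    show ?case by (simp add: pairing_def sq_summable_def)
  next
    case (Cons p G)
    have "pairing b (p # G) = (\<lambda>k. cinner (fst p) (b k (snd p)) + pairing b G k)"
      by (simp add: pairing_def fun_eq_iff split_def)
    moreover have "sq_summable (\<lambda>k. cinner (fst p) (b k (snd p)))"
      by (rule sq_summable_bound) (rule vec)
    ultimately show ?case using Cons.IH by (simp add: sq_summable_add)
  qed
  have E_sq: "sq_summable f" if "f \<in> E" for f using that pairing_sq by (auto simp: E_def)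
  have E0: "(\<lambda>k. 0) \<in> E"
  proof -
    have "(\<lambda>k. 0) = pairing b []" by (simp add: pairing_def fun_eq_iff)
    then show ?thesis by (simp add: E_def)
  qed
  have E_add: "(\<lambda>k. f k + g k) \<in> E" if fg: "f \<in> E" "g \<in> E" for f g
  proof -
    obtain G G' where "f = pairing b G" "g = pairing b G'" using fg unfolding E_def by blast
    then have "(\<lambda>k. f k + g k) = pairing b (G @ G')" by (simp add: pairing_def fun_eq_iff)
    then show ?thesis by (simp add: E_def)
  qed
  have E_scale: "(\<lambda>k. c * f k) \<in> E" if f: "f \<in> E" for f c
  proof -
    obtain G where G: "f = pairing b G" using f unfolding E_def by blast
    have "c * pairing b G k = pairing b (map (\<lambda>p. (scaleC (cnj c) (fst p), snd p)) G) k" for k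
      unfolding pairing_def by (induction G) (auto simp: cinner_scaleC_left algebra_simps)
    then have "(\<lambda>k. c * f k) = pairing b (map (\<lambda>p. (scaleC (cnj c) (fst p), snd p)) G)"
      by (simp add: G fun_eq_iff)
    then show ?thesis by (simp add: E_def)
  qed

  define e :: "'i \<Rightarrow> 'i \<Rightarrow> complex" where "e i k = (if k = i then 1 else 0)" for i k
  have e_sum: "((\<lambda>k. (cmod (e i k))\<^sup>2) has_sum 1) UNIV" for i
    by (rule has_sum_finite_neutralI[of "{i}"]) (auto simp: e_def)
  then have e: "sq_summable (e i)" "l2_sq (e i) = 1" for i
    by (auto simp: sq_summable_def l2_sq_def infsumI summable_on_def)

  define \<mu> where "\<mu> = real (card M)"
  \<comment> \<open>C collects the errors of imperfect orthogonality: \<mu> for \<open>S2\<close>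
    and 3 \<mu>^2 for \<open>T2\<close>, where 3 bounds the l2 norm of the approximants. The choice
    of \<open>\<epsilon>\<close> keeps them below 2 \<delta>^2, a value for which the final
    quadratic inequality factors.\<close>
  define C where "C = (\<mu> + 3 * (\<mu> * \<mu>)) * \<beta>\<^sup>2"
  define \<epsilon> where "\<epsilon> = min 1 (2 * \<delta>\<^sup>2 / (C + 1))"
  have C0: "0 \<le> C" by (simp add: C_def \<mu>_def)
  have \<epsilon>: "0 < \<epsilon>" "\<epsilon> \<le> 1" using C0 \<delta> by (auto simp: \<epsilon>_def)
  have "\<epsilon> * C \<le> 2 * \<delta>\<^sup>2 / (C + 1) * C" using C0 by (intro mult_right_mono) (auto simp: \<epsilon>_def)
  also have "\<dots> \<le> 2 * \<delta>\<^sup>2" using C0 by (simp add: field_simps)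
  finally have \<epsilon>C: "\<epsilon> * C \<le> 2 * \<delta>\<^sup>2" .

  have "\<exists>G. l2_sq (pairing b G) \<le> 9 \<and>
      (\<forall>g\<in>E. cmod (l2_inner (\<lambda>k. e i k - pairing b G k) g) \<le> \<epsilon> * sqrt (l2_sq g))" for i
    using almost_orthogonal_approximation[OF E_sq E0 E_add E_scale e \<epsilon>, of i] by (auto simp: E_def)
  then obtain G where G9: "\<And>i. l2_sq (pairing b (G i)) \<le> 9"
    and orth: "\<And>i g. g \<in> E \<Longrightarrow> cmod (l2_inner (\<lambda>k. e i k - pairing b (G i) k) g) \<le> \<epsilon> * sqrt (l2_sq g)"
    by metis
  define r where "r i k = e i k - pairing b (G i) k" for i k
  have r_sq: "sq_summable (r i)" for i
    unfolding r_def by (rule sq_summable_diff[OF e(1) pairing_sq])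
  have orth': "cmod (l2_inner (r i) g) \<le> \<epsilon> * sqrt (l2_sq g)" if "g \<in> E" for i g
    using orth[OF that] by (simp add: r_def[abs_def])

  have "norm ((\<Sum>i\<in>M. a i (b i v)) - (\<Sum>i\<in>M. \<Sum>k\<in>F. scaleC (pairing b (G i) k) (a k (b i v))))
      \<le> 2 * \<alpha> * \<delta> * norm v" if F: "finite F" "M \<subseteq> F" for F v
  proof -
    define w where "w i = b i v" for i
    define z where "z k = (\<Sum>i\<in>M. scaleC (r i k) (w i))" for k
    define c where "c i j = cinner (w i) (w j)" for i j
    have w: "norm (w i) \<le> \<beta> * norm v" for i
    proof (rule power2_le_imp_le)
      show "(norm (w i))\<^sup>2 \<le> (\<beta> * norm v)\<^sup>2"
        using col[of "{i}" v] by (simp add: w_def power_mult_distrib)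
    qed (simp add: \<beta>)
    have c: "cmod (c i j) \<le> \<beta>\<^sup>2 * (norm v)\<^sup>2" for i j
    proof -
      have "cmod (c i j) \<le> norm (w i) * norm (w j)" by (simp add: c_def norm_cinner_le)
      also have "\<dots> \<le> (\<beta> * norm v) * (\<beta> * norm v)" by (intro mult_mono w) (simp_all add: \<beta>)
      finally show ?thesis by (simp add: power2_eq_square algebra_simps)
    qed
    \<comment> \<open>\<open>S2\<close> is the full pairing of z with the column b v and
      \<open>T1\<close> its part over M, so \<open>S2 - T1\<close> is the part off M.
      \<open>T2\<close> is the error from r_i being only nearly orthogonal to E, and the square sum
      of z is \<open>T1 - T2\<close>.\<close>
    define S2 where "S2 = (\<Sum>i\<in>M. l2_inner (r i) (\<lambda>k. cinner (w i) (b k v)))"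
    define T1 where "T1 = (\<Sum>j\<in>M. cinner (z j) (b j v))"
    define T2 where "T2 = (\<Sum>i\<in>M. \<Sum>j\<in>M. l2_inner (r i) (pairing b (G j)) * c i j)"
    define Z where "Z = Re (T1 - T2)"

    have inner_rr: "l2_inner (r i) (r j) = cnj (r i j) - l2_inner (r i) (pairing b (G j))" for i j
    proof -
      have "((\<lambda>k. cnj (r i k) * e j k) has_sum cnj (r i j)) UNIV"
        by (rule has_sum_finite_neutralI[of "{j}"]) (auto simp: e_def)
      then have "l2_inner (r i) (e j) = cnj (r i j)" by (simp add: l2_inner_def infsumI)
      then show ?thesis
        using l2_inner_diff_right[OF r_sq e(1) pairing_sq, of i j "G j"] by (simp add: r_def[abs_def])
    qed
    have Z_sum: "((\<lambda>k. (norm (z k))\<^sup>2) has_sum Z) UNIV"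
    proof -
      have "((\<lambda>k. \<Sum>i\<in>M. \<Sum>j\<in>M. (cnj (r i k) * r j k) * c i j)
          has_sum (\<Sum>i\<in>M. \<Sum>j\<in>M. l2_inner (r i) (r j) * c i j)) UNIV"
        by (intro has_sum_sum has_sum_cmult_left has_sum_l2_inner r_sq)
      moreover have "(\<Sum>i\<in>M. \<Sum>j\<in>M. (cnj (r i k) * r j k) * c i j) = of_real ((norm (z k))\<^sup>2)" for k
        unfolding cinner_self_norm[symmetric] z_def c_def cinner_sum_left
        unfolding cinner_sum_right
        by (simp add: cinner_scaleC_left cinner_scaleC_right mult_ac)
      moreover have "(\<Sum>i\<in>M. \<Sum>j\<in>M. l2_inner (r i) (r j) * c i j) = T1 - T2"
      proof -
        have "T1 = (\<Sum>j\<in>M. \<Sum>i\<in>M. cnj (r i j) * c i j)"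
          by (simp add: T1_def z_def c_def w_def cinner_sum_left cinner_scaleC_left)
        also have "\<dots> = (\<Sum>i\<in>M. \<Sum>j\<in>M. cnj (r i j) * c i j)" by (rule sum.swap)
        finally show ?thesis
          unfolding T2_def inner_rr by (simp add: left_diff_distrib sum_subtractf)
      qed
      ultimately have "((\<lambda>k. complex_of_real ((norm (z k))\<^sup>2)) has_sum (T1 - T2)) UNIV" by simp
      from has_sum_bounded_linear[OF bounded_linear_Re this] show ?thesis
        by (simp add: Z_def del: of_real_power)
    qed
    have sum_le_Z: "(\<Sum>k\<in>F. (norm (z k))\<^sup>2) \<le> Z" if "finite F" for F
      by (rule finite_sum_le_has_sum[OF Z_sum that]) auto
    have Z0: "0 \<le> Z" using sum_le_Z[of "{}"] by simp

    have "((\<lambda>k. cinner (z k) (b k v)) has_sum S2) UNIV"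
    proof -
      have "((\<lambda>k. \<Sum>i\<in>M. cnj (r i k) * cinner (w i) (b k v)) has_sum S2) UNIV"
        unfolding S2_def by (intro has_sum_sum has_sum_l2_inner r_sq E_sq vec_E)
      then show ?thesis by (simp add: z_def cinner_sum_left cinner_scaleC_left)
    qed
    then have "((\<lambda>k. cinner (z k) (b k v)) has_sum (S2 - T1)) (UNIV - M)"
      unfolding T1_def by (rule has_sum_Diff) (auto simp: M)
    then have S2T1: "cmod (S2 - T1) \<le> sqrt Z * (\<delta> * norm v)"
    proof (rule norm_has_sum_le)
      fix F assume F: "finite F" "F \<subseteq> UNIV - M"
      have "cmod (\<Sum>k\<in>F. cinner (z k) (b k v))
          \<le> sqrt (\<Sum>k\<in>F. (norm (z k))\<^sup>2) * sqrt (\<Sum>k\<in>F. (norm (b k v))\<^sup>2)"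
        by (rule norm_sum_cinner_le)
      also have "\<dots> \<le> sqrt Z * sqrt (\<delta>\<^sup>2 * (norm v)\<^sup>2)"
        using F sum_le_Z tail[of F v] Z0
        by (intro mult_mono real_sqrt_le_mono) (auto simp: sum_nonneg)
      finally show "cmod (\<Sum>k\<in>F. cinner (z k) (b k v)) \<le> sqrt Z * (\<delta> * norm v)"
        using \<delta> by (simp add: real_sqrt_mult)
    qed
    have S2: "cmod S2 \<le> \<mu> * (\<epsilon> * (\<beta>\<^sup>2 * (norm v)\<^sup>2))"
    proof -
      have "cmod (l2_inner (r i) (\<lambda>k. cinner (w i) (b k v))) \<le> \<epsilon> * (\<beta>\<^sup>2 * (norm v)\<^sup>2)" for i
      proof -
        have "l2_sq (\<lambda>k. cinner (w i) (b k v)) \<le> (norm (w i) * (\<beta> * norm v))\<^sup>2"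
          by (rule sq_summable_bound) (rule vec)
        then have "sqrt (l2_sq (\<lambda>k. cinner (w i) (b k v))) \<le> norm (w i) * (\<beta> * norm v)"
          using \<beta> by (intro real_le_lsqrt) (auto simp: l2_sq_nonneg)
        also have "\<dots> \<le> (\<beta> * norm v) * (\<beta> * norm v)" by (intro mult_right_mono w) (simp add: \<beta>)
        finally have "\<epsilon> * sqrt (l2_sq (\<lambda>k. cinner (w i) (b k v))) \<le> \<epsilon> * ((\<beta> * norm v) * (\<beta> * norm v))"
          using \<epsilon> by (intro mult_left_mono) auto
        then show ?thesis
          using orth'[OF vec_E, of i "w i" v] by (simp add: power2_eq_square algebra_simps)
      qed
      then show ?thesis
        unfolding S2_def \<mu>_def by (intro order_trans[OF norm_sum sum_bounded_above])
    qed
    have T2: "cmod T2 \<le> \<mu> * (\<mu> * (\<epsilon> * 3 * (\<beta>\<^sup>2 * (norm v)\<^sup>2)))"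
    proof -
      have "cmod (l2_inner (r i) (pairing b (G j)) * c i j) \<le> \<epsilon> * 3 * (\<beta>\<^sup>2 * (norm v)\<^sup>2)" for i j
        unfolding norm_mult
      proof (intro mult_mono c)
        have "sqrt (l2_sq (pairing b (G j))) \<le> 3"
          using G9[of j] by (intro real_le_lsqrt) (auto simp: l2_sq_nonneg)
        then have "\<epsilon> * sqrt (l2_sq (pairing b (G j))) \<le> \<epsilon> * 3"
          using \<epsilon> by (intro mult_left_mono) auto
        then show "cmod (l2_inner (r i) (pairing b (G j))) \<le> \<epsilon> * 3"
          using orth'[of "pairing b (G j)" i] by (simp add: E_def)
      qed (use \<epsilon> in auto)
      then show ?thesis
        unfolding T2_def \<mu>_def
        by (intro order_trans[OF norm_sum sum_bounded_above] order_trans[OF norm_sum sum_bounded_above])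
    qed

    have "Z \<le> cmod (T1 - T2)" unfolding Z_def by (rule complex_Re_le_cmod)
    also have "\<dots> \<le> cmod S2 + cmod (S2 - T1) + cmod T2"
    proof -
      have "cmod (T1 - T2) \<le> cmod T1 + cmod T2" by (rule norm_triangle_ineq4)
      moreover have "cmod T1 \<le> cmod S2 + cmod (S2 - T1)"
        using norm_triangle_ineq4[of S2 "S2 - T1"] by simp
      ultimately show ?thesis by linarith
    qed
    also have "\<dots> \<le> sqrt Z * (\<delta> * norm v) + \<epsilon> * C * (norm v)\<^sup>2"
      using S2 S2T1 T2 by (simp add: C_def algebra_simps)
    also have "\<dots> \<le> sqrt Z * (\<delta> * norm v) + 2 * \<delta>\<^sup>2 * (norm v)\<^sup>2"
      using \<epsilon>C by (intro add_left_mono mult_right_mono) auto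
    finally have Zle: "Z \<le> sqrt Z * (\<delta> * norm v) + 2 * (\<delta> * norm v)\<^sup>2"
      by (simp add: power_mult_distrib algebra_simps)
    \<comment> \<open>With t = sqrt Z and d = \<delta> ||v||, the inequality t^2 <= t d + 2 d^2 says
      (t - 2 d)(t + d) <= 0.\<close>
    have sqrtZ: "sqrt Z \<le> 2 * (\<delta> * norm v)"
    proof (rule ccontr)
      let ?t = "sqrt Z" and ?d = "\<delta> * norm v"
      assume "\<not> ?t \<le> 2 * ?d"
      moreover have "0 \<le> ?d" using \<delta> by simp
      ultimately have "0 < (?t - 2 * ?d) * (?t + ?d)" by (intro mult_pos_pos) linarith+
      moreover have "?t * ?t = Z" using Z0 by simp
      ultimately show False using Zle by (simp add: power2_eq_square algebra_simps)
    qed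

    \<comment> \<open>Each r_i splits into e_i, which returns a_i because M lies in F, and the
      approximant, which returns the subtracted double sum.\<close>
    have "(\<Sum>k\<in>F. a k (z k))
        = (\<Sum>k\<in>F. \<Sum>i\<in>M. scaleC (e i k) (a k (w i)) - scaleC (pairing b (G i) k) (a k (w i)))"
      unfolding z_def r_def
      by (simp add: bounded_opsD(8)[OF a_op] bounded_opsD(2)[OF a_op] bounded_opsD(4)[OF a_op]
          scaleC_diff_left)
    also have "\<dots> = (\<Sum>i\<in>M. \<Sum>k\<in>F. scaleC (e i k) (a k (w i)) - scaleC (pairing b (G i) k) (a k (w i)))"
      by (rule sum.swap)
    also have "\<dots> = (\<Sum>i\<in>M. \<Sum>k\<in>F. scaleC (e i k) (a k (w i)))
        - (\<Sum>i\<in>M. \<Sum>k\<in>F. scaleC (pairing b (G i) k) (a k (w i)))"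
      by (simp add: sum_subtractf)
    also have "(\<Sum>i\<in>M. \<Sum>k\<in>F. scaleC (e i k) (a k (w i))) = (\<Sum>i\<in>M. a i (w i))"
    proof (rule sum.cong[OF refl])
      fix i assume "i \<in> M"
      have "(\<Sum>k\<in>F. scaleC (e i k) (a k (w i))) = (\<Sum>k\<in>F. if k = i then a k (w i) else 0)"
        by (intro sum.cong) (auto simp: e_def)
      then show "(\<Sum>k\<in>F. scaleC (e i k) (a k (w i))) = a i (w i)"
        using F \<open>i \<in> M\<close> by (auto simp: sum.delta)
    qed
    finally have "norm ((\<Sum>i\<in>M. a i (w i)) - (\<Sum>i\<in>M. \<Sum>k\<in>F. scaleC (pairing b (G i) k) (a k (w i))))
        = norm (\<Sum>k\<in>F. a k (z k))" by simp
    also have "\<dots> \<le> \<alpha> * sqrt (\<Sum>k\<in>F. (norm (z k))\<^sup>2)"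
      by (rule norm_row_apply_le[OF a_op \<alpha> row[OF F(1)]])
    also have "\<dots> \<le> \<alpha> * sqrt Z"
      using \<alpha> sum_le_Z[OF F(1)] by (intro mult_left_mono real_sqrt_le_mono) auto
    also have "\<dots> \<le> \<alpha> * (2 * (\<delta> * norm v))" using \<alpha> sqrtZ by (intro mult_left_mono) auto
    finally show ?thesis by (simp add: w_def algebra_simps)
  qed
  then show ?thesis by blast
qed

section \<open>The diagonal\<close>

lemma norm_sum_list_le:
  fixes f :: "'b \<Rightarrow> 'a::real_normed_vector"
  assumes "\<And>p. p \<in> set G \<Longrightarrow> norm (f p) \<le> g p"
  shows "norm (\<Sum>p\<leftarrow>G. f p) \<le> (\<Sum>p\<leftarrow>G. g p)"
  using assms
proof (induction G)
  case (Cons p G)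
  have "norm (f p + (\<Sum>p\<leftarrow>G. f p)) \<le> norm (f p) + norm (\<Sum>p\<leftarrow>G. f p)" by (rule norm_triangle_ineq)
  also have "\<dots> \<le> g p + (\<Sum>p\<leftarrow>G. g p)" using Cons by (intro add_mono) auto
  finally show ?case by simp
qed simp

lemma haagerup_norm_nonneg:
  assumes "A \<subseteq> bounded_ops" and "set L \<subseteq> A \<times> A"
  shows "0 \<le> haagerup_norm A L"
  unfolding haagerup_norm_def
proof (rule cInf_greatest)
  show "{row_fac L' * col_fac L' |L'. set L' \<subseteq> A \<times> A \<and> tens L' = tens L} \<noteq> {}"
    using assms(2) by blast
next
  fix t assume "t \<in> {row_fac L' * col_fac L' |L'. set L' \<subseteq> A \<times> A \<and> tens L' = tens L}"
  then obtain L' where L': "t = row_fac L' * col_fac L'" "set L' \<subseteq> A \<times> A" by blast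
  moreover have "set L' \<subseteq> bounded_ops \<times> bounded_ops" using L'(2) assms(1) by blast
  ultimately show "0 \<le> t" by (simp add: row_fac_bound(1) col_fac_bound(1))
qed

text \<open>Left multiplication acts on the leg that survives slicing; right multiplication is
  absorbed into the functional, replacing y by T y.\<close>

lemma slice_commutator:
  assumes "T \<in> bounded_ops"
  shows "slice \<eta> y (map (\<lambda>i. (T \<circ> a i, b i)) [0..<n] @ map (\<lambda>i. (- a i, b i \<circ> T)) [0..<n]) x
    = T (slice \<eta> y (map (\<lambda>i. (a i, b i)) [0..<n]) x) - slice \<eta> (T y) (map (\<lambda>i. (a i, b i)) [0..<n]) x"
  by (induction n) (auto simp: slice_def bounded_opsD[OF assms] scaleC_minus_right)

text \<open>Enlarging \<open>F\<close> to the full blocks that it meets only adds nonnegative terms.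
  Recording which blocks are met lets the same bound serve the whole family and its tails.\<close>

lemma sum_le_sum_of_block_bounds:
  fixes f :: "nat \<times> nat \<Rightarrow> real"
  assumes F: "finite F" and f0: "\<And>p. 0 \<le> f p" and out: "\<And>j i. l j \<le> i \<Longrightarrow> f (j, i) = 0"
    and block: "\<And>j. (\<Sum>i<l j. f (j, i)) \<le> s j * C"
  shows "sum f F \<le> (\<Sum>j\<in>fst ` {p \<in> F. snd p < l (fst p)}. s j) * C"
proof -
  let ?F = "{p \<in> F. snd p < l (fst p)}"
  have "sum f F = sum f ?F"
  proof (rule sum.mono_neutral_right[OF F])
    show "\<forall>p\<in>F - ?F. f p = 0"
      using out[of "fst p" "snd p" for p] by (auto simp: not_less)
  qed auto
  also have "\<dots> \<le> sum f (Sigma (fst ` ?F) (\<lambda>j. {..<l j}))"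
    using F f0 by (intro sum_mono2 finite_SigmaI) force+
  also have "\<dots> = (\<Sum>j\<in>fst ` ?F. \<Sum>i<l j. f (j, i))"
    using F by (subst sum.Sigma) auto
  also have "\<dots> \<le> (\<Sum>j\<in>fst ` ?F. s j * C)" by (intro sum_mono block)
  finally show ?thesis by (simp add: sum_distrib_right)
qed

text \<open>Smallness in the Haagerup norm concerns some representation of a tensor, not the given
  one. So the series is cut where its tails fall below 4^-j, and each block is replaced by a
  balanced representation.\<close>

lemma block_decomposition:
  fixes a0 b0 :: "nat \<Rightarrow> 'h::chilbert_space \<Rightarrow> 'h"
  assumes A: "unital_subalgebra A" and mem: "\<And>i. a0 i \<in> A" "\<And>i. b0 i \<in> A"
    and cauchy: "\<And>e. e > 0 \<Longrightarrow> \<exists>N. \<forall>m n. N \<le> m \<longrightarrow> m \<le> n \<longrightarrow>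
         haagerup_norm A (map (\<lambda>i. (a0 i, b0 i)) [m..<n]) < e"
  obtains N :: "nat \<Rightarrow> nat" and L s
  where "\<And>j. j \<le> N j" and "\<And>j. set (L j) \<subseteq> A \<times> A" and "summable s" and "\<And>j. 0 < (s j :: real)"
    and "\<And>J. tens (concat (map L [0..<Suc J])) = tens (map (\<lambda>i. (a0 i, b0 i)) [0..<N J])"
    and "\<And>j x. (\<Sum>(a, b)\<leftarrow>L j. (norm (adj a x))\<^sup>2) \<le> s j * (norm x)\<^sup>2"
    and "\<And>j x. (\<Sum>(a, b)\<leftarrow>L j. (norm (b x))\<^sup>2) \<le> s j * (norm x)\<^sup>2"
proof -
  have AB: "A \<subseteq> bounded_ops" using A by (auto simp: unital_subalgebra_def)
  define U where "U m n = map (\<lambda>i. (a0 i, b0 i)) [m..<n]" for m n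
  have U: "set (U m n) \<subseteq> A \<times> A" for m n using mem by (auto simp: U_def)
  have "\<exists>N. \<forall>m n. N \<le> m \<longrightarrow> m \<le> n \<longrightarrow> haagerup_norm A (U m n) < ((1/2) ^ j)\<^sup>2" for j :: nat
    unfolding U_def by (rule cauchy) simp
  then obtain N0 where N0: "\<And>j m n. N0 j \<le> m \<Longrightarrow> m \<le> n \<Longrightarrow> haagerup_norm A (U m n) < ((1/2) ^ j)\<^sup>2"
    by metis
  \<comment> \<open>Summing the thresholds makes N monotone and at least N0; the extra j forces N to
    tend to infinity.\<close>
  define N where "N j = j + (\<Sum>i\<le>j. N0 i)" for j
  have NN: "N0 j \<le> N j" for j
    using member_le_sum[of j "{..j}" N0] by (simp add: N_def)
  have N_Suc: "N j \<le> N (Suc j)" for j by (simp add: N_def)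
  have "\<exists>L'. set L' \<subseteq> A \<times> A \<and> tens L' = tens (U (N j) (N (Suc j))) \<and>
      (\<forall>x. (\<Sum>(a, b)\<leftarrow>L'. (norm (adj a x))\<^sup>2) \<le> ((1/2) ^ j)\<^sup>2 * (norm x)\<^sup>2) \<and>
      (\<forall>x. (\<Sum>(a, b)\<leftarrow>L'. (norm (b x))\<^sup>2) \<le> ((1/2) ^ j)\<^sup>2 * (norm x)\<^sup>2)" for j
    by (rule balanced_representation[OF A U _ N0[OF NN N_Suc]]) simp
  then obtain L' where L'A: "\<And>j. set (L' j) \<subseteq> A \<times> A"
    and L't: "\<And>j. tens (L' j) = tens (U (N j) (N (Suc j)))"
    and L'r: "\<And>j x. (\<Sum>(a, b)\<leftarrow>L' j. (norm (adj a x))\<^sup>2) \<le> ((1/2) ^ j)\<^sup>2 * (norm x)\<^sup>2"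
    and L'c: "\<And>j x. (\<Sum>(a, b)\<leftarrow>L' j. (norm (b x))\<^sup>2) \<le> ((1/2) ^ j)\<^sup>2 * (norm x)\<^sup>2"
    by metis
  \<comment> \<open>Block 0 is the unaltered initial segment; its weight in \<open>s\<close> is the
    sum of both squared factors, plus 1 for positivity. The balanced blocks follow, shifted by one
    index.\<close>
  define L where "L j = (case j of 0 \<Rightarrow> U 0 (N 0) | Suc i \<Rightarrow> L' i)" for j
  define s where "s j = (case j of 0 \<Rightarrow> (row_fac (L 0))\<^sup>2 + (col_fac (L 0))\<^sup>2 + 1
    | Suc i \<Rightarrow> ((1/2::real) ^ i)\<^sup>2)" for j
  have LA: "set (L j) \<subseteq> A \<times> A" for j using U L'A by (simp add: L_def split: nat.split)
  have LB: "set (L j) \<subseteq> bounded_ops \<times> bounded_ops" for j using LA[of j] AB by blast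
  show ?thesis
  proof (rule that[of N L s])
    show "j \<le> N j" for j by (simp add: N_def)
    show "set (L j) \<subseteq> A \<times> A" for j by (rule LA)
    have "summable (\<lambda>j. ((1/2::real) ^ j)\<^sup>2)"
      using summable_geometric[of "1/4::real"]
      by (simp add: power2_eq_square power_mult_distrib[symmetric])
    then show "summable s" using summable_Suc_iff[of s] by (simp add: s_def)
    show "0 < s j" for j
      by (simp add: s_def add_nonneg_pos split: nat.split)
    show "tens (concat (map L [0..<Suc J])) = tens (map (\<lambda>i. (a0 i, b0 i)) [0..<N J])" for J
      unfolding U_def[symmetric]
    proof (induction J)
      case (Suc J)
      have "U 0 (N (Suc J)) = U 0 (N J) @ U (N J) (N (Suc J))"
        using upt_add_eq_append[of 0 "N J" "N (Suc J) - N J"] N_Suc[of J] by (simp add: U_def)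
      then have "tens (U 0 (N (Suc J))) =
          (\<lambda>\<xi> x \<eta> y. tens (concat (map L [0..<Suc J])) \<xi> x \<eta> y + tens (L (Suc J)) \<xi> x \<eta> y)"
        by (simp add: tens_append Suc.IH L't L_def del: upt_Suc)
      also have "\<dots> = tens (concat (map L [0..<Suc (Suc J)]))"
        unfolding tens_append[symmetric] by simp
      finally show ?case ..
    qed (simp add: L_def)
    show "(\<Sum>(a, b)\<leftarrow>L j. (norm (adj a x))\<^sup>2) \<le> s j * (norm x)\<^sup>2" for j x
    proof (cases j)
      case 0
      have "(row_fac (L 0))\<^sup>2 * (norm x)\<^sup>2 \<le> s 0 * (norm x)\<^sup>2"
        by (intro mult_right_mono) (auto simp: s_def)
      then show ?thesis using row_fac_bound(2)[OF LB[of 0], of x] 0 by simp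
    next
      case (Suc i)
      then show ?thesis using L'r[where j = i] by (simp add: L_def s_def)
    qed
    show "(\<Sum>(a, b)\<leftarrow>L j. (norm (b x))\<^sup>2) \<le> s j * (norm x)\<^sup>2" for j x
    proof (cases j)
      case 0
      have "(col_fac (L 0))\<^sup>2 * (norm x)\<^sup>2 \<le> s 0 * (norm x)\<^sup>2"
        by (intro mult_right_mono) (auto simp: s_def)
      then show ?thesis using col_fac_bound(2)[OF LB[of 0], of x] 0 by simp
    next
      case (Suc i)
      then show ?thesis using L'c[where j = i] by (simp add: L_def s_def)
    qed
  qed
qed

theorem theorem2p1:
  fixes A :: "('h::chilbert_space \<Rightarrow> 'h) set"
  assumes "unital_subalgebra A"
    and "has_diagonal A"
  shows "finite_dim_ops A"
proof -
  note A = assms(1)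
  have AB: "A \<subseteq> bounded_ops" and A_id: "id \<in> A"
    and A_add: "\<And>S T. S \<in> A \<Longrightarrow> T \<in> A \<Longrightarrow> (\<lambda>x. S x + T x) \<in> A"
    and A_scale: "\<And>c T. T \<in> A \<Longrightarrow> (\<lambda>x. scaleC c (T x)) \<in> A"
    and A_comp: "\<And>S T. S \<in> A \<Longrightarrow> T \<in> A \<Longrightarrow> S \<circ> T \<in> A"
    using A by (auto simp: unital_subalgebra_def)
  have A0: "(\<lambda>x. 0) \<in> A" using A_scale[OF A_id, of 0] by simp
  have A_minus: "- T \<in> A" if "T \<in> A" for T
    using A_scale[OF that, of "-1"] by (simp add: scaleC_minus_one fun_Compl_def)
  from assms(2) obtain a0 b0 :: "nat \<Rightarrow> 'h \<Rightarrow> 'h" where mem: "\<And>i. a0 i \<in> A" "\<And>i. b0 i \<in> A"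
    and cauchy: "\<And>e. e > 0 \<Longrightarrow> \<exists>N. \<forall>m n. N \<le> m \<longrightarrow> m \<le> n \<longrightarrow>
         haagerup_norm A (map (\<lambda>i. (a0 i, b0 i)) [m..<n]) < e"
    and unit: "(\<lambda>n. onorm (\<lambda>x. (\<Sum>i<n. a0 i (b0 i x)) - x)) \<longlonglongrightarrow> 0"
    and comm: "\<And>c. c \<in> A \<Longrightarrow> (\<lambda>n. haagerup_norm A
         (map (\<lambda>i. (c \<circ> a0 i, b0 i)) [0..<n] @ map (\<lambda>i. (- a0 i, b0 i \<circ> c)) [0..<n])) \<longlonglongrightarrow> 0"
    unfolding has_diagonal_def by blast
  define U where "U m n = map (\<lambda>i. (a0 i, b0 i)) [m..<n]" for m n
  have U: "set (U m n) \<subseteq> A \<times> A" for m n using mem by (auto simp: U_def)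
  from block_decomposition[OF A mem cauchy]
  obtain N :: "nat \<Rightarrow> nat" and L s where N: "\<And>j. j \<le> N j" and LA: "\<And>j. set (L j) \<subseteq> A \<times> A"
    and s: "summable s" "\<And>j. 0 < (s j :: real)"
    and L_tens: "\<And>J. tens (concat (map L [0..<Suc J])) = tens (U 0 (N J))"
    and L_row: "\<And>j x. (\<Sum>(a, b)\<leftarrow>L j. (norm (adj a x))\<^sup>2) \<le> s j * (norm x)\<^sup>2"
    and L_col: "\<And>j x. (\<Sum>(a, b)\<leftarrow>L j. (norm (b x))\<^sup>2) \<le> s j * (norm x)\<^sup>2"
    unfolding U_def by blast

  define l where "l j = length (L j)" for j
  \<comment> \<open>Blocks of varying length are indexed by pairs (block, position) and padded with
    zero operators, so that the families are defined on all pairs.\<close>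
  define a where "a p = (if snd p < l (fst p) then fst (L (fst p) ! snd p) else (\<lambda>x. 0))" for p
  define b where "b p = (if snd p < l (fst p) then snd (L (fst p) ! snd p) else (\<lambda>x. 0))" for p
  have "fst (L j ! i) \<in> A" "snd (L j ! i) \<in> A" if "i < l j" for i j
    using subsetD[OF LA nth_mem[of i "L j"]] that by (auto simp: l_def mem_Times_iff)
  then have ab: "a p \<in> bounded_ops" "b p \<in> bounded_ops" for p
    using AB A0 by (auto simp: a_def b_def)
  \<comment> \<open>The blocks up to J represent the same tensor as the first \<open>N J\<close>
    terms of the given series, so products and slices can be exchanged between the two
    families.\<close>
  define I where "I J = Sigma {..J} (\<lambda>j. {..<l j})" for J
  have I_fin: "finite (I J)" for J by (simp add: I_def)
  have I_mono: "I J \<subseteq> I K" if "J \<le> K" for J K using that by (auto simp: I_def)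
  have I_sum: "(\<Sum>p\<in>I J. g (a p) (b p)) = (\<Sum>(a, b)\<leftarrow>concat (map L [0..<Suc J]). g a b)"
    for J and g :: "('h \<Rightarrow> 'h) \<Rightarrow> ('h \<Rightarrow> 'h) \<Rightarrow> 'h"
  proof -
    have "(\<Sum>p\<in>I J. g (a p) (b p)) = (\<Sum>j\<le>J. \<Sum>i<l j. g (a (j, i)) (b (j, i)))"
      unfolding I_def by (subst sum.Sigma) auto
    also have "\<dots> = (\<Sum>j\<le>J. \<Sum>(a, b)\<leftarrow>L j. g a b)"
      by (intro sum.cong refl) (simp add: a_def b_def sum_list_conv_sum_nth l_def split_def)
    also have "\<dots> = (\<Sum>(a, b)\<leftarrow>concat (map L [0..<Suc J]). g a b)"
      by (induction J) (simp_all add: add.commute)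
    finally show ?thesis .
  qed
  have I_product: "(\<Sum>p\<in>I J. a p (b p v)) = (\<Sum>i<N J. a0 i (b0 i v))" for J v
  proof -
    have "(\<Sum>p\<in>I J. a p (b p v)) = (\<Sum>(a, b)\<leftarrow>concat (map L [0..<Suc J]). a (b v))"
      by (rule I_sum)
    also have "\<dots> = (\<Sum>(a, b)\<leftarrow>U 0 (N J). a (b v))"
    proof (rule product_cong_tens[OF _ _ L_tens])
      show "set (concat (map L [0..<Suc J])) \<subseteq> bounded_ops \<times> bounded_ops"
        using LA AB by fastforce
      show "set (U 0 (N J)) \<subseteq> bounded_ops \<times> bounded_ops" using U AB by blast
    qed
    also have "\<dots> = (\<Sum>i<N J. a0 i (b0 i v))"
      by (simp add: U_def o_def sum_list_conv_sum_nth)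
    finally show ?thesis .
  qed
  have I_slice: "(\<Sum>p\<in>I J. scaleC (cinner \<eta> (b p y)) (a p x)) = slice \<eta> y (U 0 (N J)) x" for J \<eta> y x
    using I_sum[of "\<lambda>a b. scaleC (cinner \<eta> (b y)) (a x)" J] slice_cong_tens[OF L_tens, of \<eta> y J x]
    by (simp add: slice_def)

  define \<sigma> where "\<sigma> = suminf s"
  have \<sigma>: "0 < \<sigma>" unfolding \<sigma>_def by (rule suminf_pos[OF s])
  define \<beta> where "\<beta> = sqrt \<sigma>"
  have \<beta>: "0 < \<beta>" "\<beta>\<^sup>2 = \<sigma>" using \<sigma> by (auto simp: \<beta>_def)
  have s_le: "(\<Sum>j\<in>S. s j) \<le> \<beta>\<^sup>2" if "finite S" for S
    unfolding \<beta>(2) \<sigma>_def using s that by (intro sum_le_suminf) (auto intro: less_imp_le)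
  have row_blocks: "(\<Sum>p\<in>F. (norm (adj (a p) x))\<^sup>2)
      \<le> (\<Sum>j\<in>fst ` {p \<in> F. snd p < l (fst p)}. s j) * (norm x)\<^sup>2" if "finite F" for F x
  proof (rule sum_le_sum_of_block_bounds[OF that])
    have "(\<lambda>x. 0) \<in> (bounded_ops :: ('h \<Rightarrow> 'h) set)" using A0 AB by blast
    then have "adj (\<lambda>x. 0) x = 0" by (intro cinner_separates[of "adj _ x"]) (simp add: cinner_adj)
    then show "(norm (adj (a (j, i)) x))\<^sup>2 = 0" if "l j \<le> i" for j i
      using that by (simp add: a_def)
    show "(\<Sum>i<l j. (norm (adj (a (j, i)) x))\<^sup>2) \<le> s j * (norm x)\<^sup>2" for j
      using L_row[of x j] by (simp add: a_def sum_list_conv_sum_nth l_def split_def)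
  qed simp
  have col_blocks: "(\<Sum>p\<in>F. (norm (b p x))\<^sup>2)
      \<le> (\<Sum>j\<in>fst ` {p \<in> F. snd p < l (fst p)}. s j) * (norm x)\<^sup>2" if "finite F" for F x
  proof (rule sum_le_sum_of_block_bounds[OF that])
    show "(norm (b (j, i) x))\<^sup>2 = 0" if "l j \<le> i" for j i
      using that by (simp add: b_def)
    show "(\<Sum>i<l j. (norm (b (j, i) x))\<^sup>2) \<le> s j * (norm x)\<^sup>2" for j
      using L_col[of x j] by (simp add: b_def sum_list_conv_sum_nth l_def split_def)
  qed simp
  have row: "(\<Sum>p\<in>F. (norm (adj (a p) x))\<^sup>2) \<le> \<beta>\<^sup>2 * (norm x)\<^sup>2" if "finite F" for F x
    by (rule order_trans[OF row_blocks[OF that] mult_right_mono[OF s_le]]) (use that in auto)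
  have col: "(\<Sum>p\<in>F. (norm (b p x))\<^sup>2) \<le> \<beta>\<^sup>2 * (norm x)\<^sup>2" if "finite F" for F x
    by (rule order_trans[OF col_blocks[OF that] mult_right_mono[OF s_le]]) (use that in auto)
  have b_le: "norm (b p x) \<le> \<beta> * norm x" for p x
  proof (rule power2_le_imp_le)
    show "(norm (b p x))\<^sup>2 \<le> (\<beta> * norm x)\<^sup>2" using col[of "{p}" x] by (simp add: power_mult_distrib)
  qed (use \<beta> in simp)

  \<comment> \<open>The approximation lemma is applied with \<alpha> = \<beta>, and its error 2
    \<alpha> \<delta> becomes 1/4.\<close>
  define \<delta> where "\<delta> = 1 / (8 * \<beta>)"
  have \<delta>: "0 < \<delta>" "2 * \<beta> * \<delta> = 1/4" using \<beta>(1) by (auto simp: \<delta>_def)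
  obtain J1 where J1: "\<And>m n. J1 \<le> m \<Longrightarrow> norm (sum s {m..<n}) < \<delta>\<^sup>2"
    using s(1) \<delta>(1) unfolding summable_Cauchy by (meson zero_less_power)
  obtain J2 where J2: "\<And>n. J2 \<le> n \<Longrightarrow> norm (onorm (\<lambda>x. (\<Sum>i<n. a0 i (b0 i x)) - x)) < 1/4"
    using LIMSEQ_D[OF unit, of "1/4"] by auto
  \<comment> \<open>Beyond block \<open>J0\<close> the column is small, and as \<open>N J0\<close>
    is at least \<open>J0\<close>, the product over M is within 1/4 of the identity.\<close>
  define J0 where "J0 = max J1 J2"
  define M where "M = I J0"
  have tail: "(\<Sum>p\<in>F. (norm (b p x))\<^sup>2) \<le> \<delta>\<^sup>2 * (norm x)\<^sup>2" if F: "finite F" "F \<inter> M = {}" for F x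
  proof -
    let ?S = "fst ` {p \<in> F. snd p < l (fst p)}"
    have "finite ?S" using F(1) by simp
    then obtain K where K: "?S \<subseteq> {..<K}" using finite_nat_bounded by blast
    have "Suc J0 \<le> j" if j: "j \<in> ?S" for j
    proof (rule ccontr)
      assume "\<not> Suc J0 \<le> j"
      moreover obtain p where "p \<in> F" "snd p < l (fst p)" "j = fst p" using j by auto
      ultimately have "p \<in> M" by (cases p) (auto simp: M_def I_def)
      then show False using \<open>p \<in> F\<close> F(2) by blast
    qed
    then have "?S \<subseteq> {Suc J0..<K}" using K by fastforce
    then have "sum s ?S \<le> sum s {Suc J0..<K}"
      by (intro sum_mono2) (auto intro: less_imp_le[OF s(2)])
    also have "\<dots> \<le> \<delta>\<^sup>2" using J1[of "Suc J0" K] by (simp add: J0_def le_SucI)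
    finally have "sum s ?S * (norm x)\<^sup>2 \<le> \<delta>\<^sup>2 * (norm x)\<^sup>2" by (rule mult_right_mono) simp
    then show ?thesis using col_blocks[OF F(1), of x] by linarith
  qed
  have M_fin: "finite M" by (simp add: M_def I_fin)
  have unit_M: "norm ((\<Sum>i\<in>M. a i (b i v)) - v) \<le> 1/4 * norm v" for v
  proof -
    let ?E = "\<lambda>x. (\<Sum>i<N J0. a0 i (b0 i x)) - x"
    have "bounded_linear ?E"
      using mem AB
      by (intro bounded_linear_sub bounded_linear_sum bounded_linear_ident
          bounded_linear_compose[OF bounded_opsD(1) bounded_opsD(1)]) auto
    then have "norm (?E v) \<le> onorm ?E * norm v" by (rule onorm)
    also have "\<dots> \<le> 1/4 * norm v"
      using J2[of "N J0"] N[of J0] by (intro mult_right_mono) (auto simp: J0_def)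
    finally show ?thesis unfolding M_def I_product .
  qed

  from row_column_approximation[OF ab M_fin less_imp_le[OF \<beta>(1)] less_imp_le[OF \<beta>(1)] \<delta>(1)
      row col tail, unfolded \<delta>(2)]
  obtain G where G: "\<And>F v. finite F \<Longrightarrow> M \<subseteq> F \<Longrightarrow>
    norm ((\<Sum>i\<in>M. a i (b i v)) - (\<Sum>i\<in>M. \<Sum>k\<in>F. scaleC (pairing b (G i) k) (a k (b i v))))
      \<le> 1/4 * norm v"
    by blast

  \<comment> \<open>\<open>\<Gamma>\<close> is the total weight of the functionals in G, with
    \<beta> for the factor b_i. Slices of relative size \<epsilon> then contribute at most
    \<epsilon> \<Gamma> <= 1/4.\<close>
  define \<Gamma> where "\<Gamma> = (\<Sum>i\<in>M. \<Sum>p\<leftarrow>G i. norm (fst p) * norm (snd p) * \<beta>)"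
  have \<Gamma>: "0 \<le> \<Gamma>"
    unfolding \<Gamma>_def using \<beta>(1) by (intro sum_nonneg sum_list_nonneg) auto
  define \<epsilon> where "\<epsilon> = 1 / (4 * (\<Gamma> + 1))"
  have \<epsilon>: "0 < \<epsilon>" "\<epsilon> * \<Gamma> \<le> 1/4" using \<Gamma> by (auto simp: \<epsilon>_def field_simps)
  obtain N1 where N1: "\<And>m n. N1 \<le> m \<Longrightarrow> m \<le> n \<Longrightarrow> haagerup_norm A (U m n) < \<epsilon>"
    using cauchy[OF \<epsilon>(1)] unfolding U_def by blast
  define P where "P = (\<Union>i\<in>M. set (G i))"

  \<comment> \<open>The functionals T |-> <\<eta>, b0_k T y> with (\<eta>, y) in P and k < N1 are
    finitely many. An element T of their joint kernel will satisfy ||T|| <= 3/4 ||T||.\<close>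
  show ?thesis
  proof (rule finite_dim_ops_if_functionals_separate
      [where J = "P \<times> {..<N1}" and \<phi> = "\<lambda>j T. cinner (fst (fst j)) (b0 (snd j) (T (snd (fst j))))"])
    show "finite (P \<times> {..<N1})" using M_fin by (simp add: P_def)
    show "(\<lambda>x. S x + T x) \<in> A" if "S \<in> A" "T \<in> A" for S T by (rule A_add[OF that])
    show "(\<lambda>x. scaleC c (T x)) \<in> A" if "T \<in> A" for c T by (rule A_scale[OF that])
    have "b0 i \<in> bounded_ops" for i using mem AB by blast
    note b0 = bounded_opsD[OF this]
    show "cinner (fst (fst j)) (b0 (snd j) (S (snd (fst j)) + T (snd (fst j))))
      = cinner (fst (fst j)) (b0 (snd j) (S (snd (fst j)))) + cinner (fst (fst j)) (b0 (snd j) (T (snd (fst j))))"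
      for j S T by (simp add: b0 cinner_add_right)
    show "cinner (fst (fst j)) (b0 (snd j) (scaleC c (T (snd (fst j)))))
      = c * cinner (fst (fst j)) (b0 (snd j) (T (snd (fst j))))"
      for j c T by (simp add: b0 cinner_scaleC_right)
  next
    fix T assume T: "T \<in> A"
      and "\<And>j. j \<in> P \<times> {..<N1} \<Longrightarrow> cinner (fst (fst j)) (b0 (snd j) (T (snd (fst j)))) = 0"
    then have ker: "cinner (fst p) (b0 k (T (snd p))) = 0" if "p \<in> P" "k < N1" for p k
      using that by force
    have Tb: "T \<in> bounded_ops" using T AB by blast
    define \<kappa> where "\<kappa> = onorm T"
    have \<kappa>: "0 \<le> \<kappa>" and T_le: "norm (T x) \<le> \<kappa> * norm x" for x
      using bounded_opsD[OF Tb] by (auto simp: \<kappa>_def onorm_pos_le)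
    define h where "h n = haagerup_norm A
         (map (\<lambda>i. (T \<circ> a0 i, b0 i)) [0..<n] @ map (\<lambda>i. (- a0 i, b0 i \<circ> T)) [0..<n])" for n
    have comm_A: "set (map (\<lambda>i. (T \<circ> a0 i, b0 i)) [0..<n] @ map (\<lambda>i. (- a0 i, b0 i \<circ> T)) [0..<n]) \<subseteq> A \<times> A" for n
      using mem T A_comp A_minus by auto
    have h0: "0 \<le> h n" for n unfolding h_def by (rule haagerup_norm_nonneg[OF AB comm_A])
    \<comment> \<open>T applied to a slice of the n-th partial sum is the slice with T y in place of
      y, up to the commutator error \<open>h n\<close>. The first N1 terms of the latter vanish by
      \<open>ker\<close>, and the tail is controlled by \<epsilon>.\<close>
    have slice_le: "norm (T (slice \<eta> y (U 0 n) x)) \<le> (\<epsilon> * \<kappa> + h n) * (norm \<eta> * norm y * norm x)"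
      if p: "(\<eta>, y) \<in> P" and n: "N1 \<le> n" for \<eta> y n x
    proof -
      have comm_eq: "slice \<eta> y (map (\<lambda>i. (T \<circ> a0 i, b0 i)) [0..<n] @ map (\<lambda>i. (- a0 i, b0 i \<circ> T)) [0..<n]) x
          = T (slice \<eta> y (U 0 n) x) - slice \<eta> (T y) (U 0 n) x"
        unfolding U_def by (rule slice_commutator[OF Tb])
      from norm_slice_le_haagerup[OF AB comm_A, of \<eta> y n x]
      have 1: "norm (T (slice \<eta> y (U 0 n) x) - slice \<eta> (T y) (U 0 n) x) \<le> h n * (norm \<eta> * norm y * norm x)"
        unfolding comm_eq h_def .
      have "U 0 n = U 0 N1 @ U N1 n"
        using upt_add_eq_append[of 0 N1 "n - N1"] n by (simp add: U_def)
      moreover have "slice \<eta> (T y) (U 0 N1) x = 0"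
        using ker[OF p] by (auto simp: slice_def U_def o_def sum_list_conv_sum_nth)
      ultimately have "slice \<eta> (T y) (U 0 n) x = slice \<eta> (T y) (U N1 n) x"
        by (simp add: slice_def)
      also have "norm \<dots> \<le> haagerup_norm A (U N1 n) * (norm \<eta> * norm (T y) * norm x)"
        by (rule norm_slice_le_haagerup[OF AB U])
      also have "\<dots> \<le> \<epsilon> * (norm \<eta> * norm (T y) * norm x)"
        using N1[OF order_refl n] by (intro mult_right_mono) auto
      also have "\<dots> \<le> \<epsilon> * (norm \<eta> * (\<kappa> * norm y) * norm x)"
        using \<epsilon>(1) T_le by (intro mult_left_mono mult_right_mono) auto
      finally have 2: "norm (slice \<eta> (T y) (U 0 n) x) \<le> \<epsilon> * \<kappa> * (norm \<eta> * norm y * norm x)"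
        by (simp add: algebra_simps)
      show ?thesis
        using norm_triangle_ineq[of "T (slice \<eta> y (U 0 n) x) - slice \<eta> (T y) (U 0 n) x" "slice \<eta> (T y) (U 0 n) x"]
          1 2 by (simp add: algebra_simps)
    qed
    \<comment> \<open>v is within ||v||/4 of S, and S within ||v||/4 of D, a sum of slices that T
      nearly annihilates. The errors 1/4 + 1/4 + \<epsilon> \<Gamma> total at most 3/4, apart from
      the commutator term.\<close>
    have T_v: "norm (T v) \<le> (3/4 * \<kappa> + h (N J) * \<Gamma>) * norm v" if J: "J0 \<le> J" "N1 \<le> J" for J v
    proof -
      define S where "S = (\<Sum>i\<in>M. a i (b i v))"
      define D where "D = (\<Sum>i\<in>M. \<Sum>k\<in>I J. scaleC (pairing b (G i) k) (a k (b i v)))"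
      define q where "q = \<epsilon> * \<kappa> + h (N J)"
      have nJ: "N1 \<le> N J" using J N[of J] by linarith
      have D_eq: "D = (\<Sum>i\<in>M. \<Sum>p\<leftarrow>G i. slice (fst p) (snd p) (U 0 (N J)) (b i v))"
        unfolding D_def
      proof (rule sum.cong[OF refl])
        fix i
        have "(\<Sum>k\<in>I J. scaleC (pairing b H k) (a k (b i v)))
            = (\<Sum>p\<leftarrow>H. slice (fst p) (snd p) (U 0 (N J)) (b i v))" for H
          by (induction H)
            (auto simp: pairing_def scaleC_add_left sum.distrib I_slice split_def)
        then show "(\<Sum>k\<in>I J. scaleC (pairing b (G i) k) (a k (b i v)))
            = (\<Sum>p\<leftarrow>G i. slice (fst p) (snd p) (U 0 (N J)) (b i v))" .
      qed
      have "norm (T D) \<le> (\<Sum>i\<in>M. \<Sum>p\<leftarrow>G i. (q * norm v) * (norm (fst p) * norm (snd p) * \<beta>))"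
        unfolding D_eq bounded_opsD(8)[OF Tb] bounded_opsD(9)[OF Tb]
      proof (rule order_trans[OF norm_sum], rule sum_mono, rule norm_sum_list_le)
        fix i p assume ip: "i \<in> M" "p \<in> set (G i)"
        then have pP: "(fst p, snd p) \<in> P" by (auto simp: P_def)
        have "norm (T (slice (fst p) (snd p) (U 0 (N J)) (b i v)))
            \<le> q * (norm (fst p) * norm (snd p) * norm (b i v))"
          unfolding q_def by (rule slice_le[OF pP nJ])
        also have "\<dots> \<le> q * (norm (fst p) * norm (snd p) * (\<beta> * norm v))"
          using \<epsilon>(1) \<kappa> h0 b_le by (intro mult_left_mono) (auto simp: q_def)
        finally show "norm (T (slice (fst p) (snd p) (U 0 (N J)) (b i v)))
            \<le> (q * norm v) * (norm (fst p) * norm (snd p) * \<beta>)"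
          by (simp add: algebra_simps)
      qed
      also have "\<dots> = q * norm v * \<Gamma>"
        by (simp add: \<Gamma>_def sum_list_const_mult sum_distrib_left)
      finally have TD: "norm (T D) \<le> q * norm v * \<Gamma>" .
      have "norm (T (S - v)) \<le> \<kappa> * (1/4 * norm v)"
        by (rule order_trans[OF T_le mult_left_mono[OF unit_M[of v, folded S_def] \<kappa>]])
      moreover have "norm (T (S - D)) \<le> \<kappa> * (1/4 * norm v)"
        by (rule order_trans[OF T_le mult_left_mono[OF _ \<kappa>]])
          (use G[OF I_fin I_mono[OF J(1), folded M_def], of v] in \<open>simp add: S_def D_def\<close>)
      moreover have "T v = T (S - D) - T (S - v) + T D" by (simp add: bounded_opsD[OF Tb])
      moreover have "norm (T (S - D) - T (S - v) + T D) \<le> norm (T (S - D)) + norm (T (S - v)) + norm (T D)"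
        by (meson norm_triangle_ineq norm_triangle_ineq4 add_right_mono order_trans)
      ultimately have "norm (T v) \<le> 1/2 * \<kappa> * norm v + q * norm v * \<Gamma>" using TD by simp
      also have "\<dots> = (1/2 * \<kappa> + \<epsilon> * \<Gamma> * \<kappa> + h (N J) * \<Gamma>) * norm v" by (simp add: q_def algebra_simps)
      also have "\<dots> \<le> (3/4 * \<kappa> + h (N J) * \<Gamma>) * norm v"
        using mult_right_mono[OF \<epsilon>(2) \<kappa>] by (intro mult_right_mono) auto
      finally show ?thesis .
    qed
    \<comment> \<open>Letting J tend to infinity removes the commutator error. As \<kappa> is the
      operator norm of T, \<kappa> <= 3/4 \<kappa> forces T = 0.\<close>
    have "filterlim N at_top sequentially"
      by (rule filterlim_at_top_mono[OF filterlim_ident]) (simp add: N)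
    then have "(\<lambda>J. h (N J)) \<longlonglongrightarrow> 0"
      using comm[OF T] unfolding h_def[symmetric] by (rule filterlim_compose[rotated])
    then have lim: "(\<lambda>J. (3/4 * \<kappa> + h (N J) * \<Gamma>) * norm v) \<longlonglongrightarrow> (3/4 * \<kappa> + 0 * \<Gamma>) * norm v" for v
      by (intro tendsto_intros)
    have "norm (T v) \<le> (3/4 * \<kappa> + 0 * \<Gamma>) * norm v" for v
      by (rule LIMSEQ_le_const[OF lim]) (use T_v in \<open>auto intro!: exI[of _ "max J0 N1"]\<close>)
    then have "norm (T v) \<le> 3/4 * \<kappa> * norm v" for v by simp
    then have "\<kappa> \<le> 3/4 * \<kappa>" unfolding \<kappa>_def by (intro onorm_bound) (use \<kappa> in \<open>auto simp: \<kappa>_def\<close>)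
    then have "\<kappa> = 0" using \<kappa> by simp
    then show "T = (\<lambda>x. 0)" using T_le by (simp add: fun_eq_iff)
  qed
qed

end
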